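(* Let $k \geq 2$ and let $\alpha,\beta \in (0,1)$ satisfy $\beta = \frac{k\alpha}{1+(k-1)\alpha}$. If $\alpha$ and $\beta$ are not computable reals, then $(\alpha,\beta) \notin \mathsf{EXT^{p}}(k)$, and a fortiori $(\alpha,\beta)\notin\mathsf{EXT}(k)$.
   Context: $C$ denotes plain Kolmogorov complexity: $C(\sigma)=\min\{|p|:\mathbb{U}(p)=\sigma\}$ for a fixed optimal machine $\mathbb{U}$. For $k \geq 1$, $\mathsf{EXT^{p}}(k)$ is the set of pairs $(\alpha,\beta)\in[0,1]^2$ for which there exist a total one-to-one computable $f:\mathbb{N}\to\mathbb{N}$, partial computable $\Gamma_1,\ldots,\Gamma_k:\{0,1\}^*\to\{0,1\}^*$ and $d\in\mathbb{N}$ such that for all $n$ and every $\sigma$ with $|\sigma|=f(n)$: $|\Gamma_i(\sigma)|=n$ for every $i$ with $\Gamma_i(\sigma)$ defined, and if $C(\sigma)\ge\alpha|\sigma|+d$ then for some $i$, $\Gamma_i(\sigma)$ is defined and $C(\Gamma_i(\sigma))\ge\beta|\Gamma_i(\sigma)|-d$. $\mathsf{EXT}(k)$ is defined identically except that $\Gamma_1,\ldots,\Gamma_k$ are required to be total computable functions. (Given the relation between $\alpha$ and $\beta$, they are either both computable or both non-computable.) *)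

theory Defs
  imports Complex_Main "HOL-Library.Nat_Bijection"
begin

text \<open>
  Partial recursive functions of one argument; several arguments are passed through the pairing
  \<^const>\<open>prod_encode\<close>. The class is the closure of zero, successor and the two projections under
  pairing, composition, primitive recursion and unbounded minimisation; all schemes are strict.
\<close>

primrec prim_recursion ::
  "(nat \<Rightarrow> nat option) \<Rightarrow> (nat \<Rightarrow> nat option) \<Rightarrow> nat \<Rightarrow> nat \<Rightarrow> nat option" where
  "prim_recursion f g a 0 = f a"
| "prim_recursion f g a (Suc n) =
     Option.bind (prim_recursion f g a n) (\<lambda>r. g (prod_encode (a, prod_encode (n, r))))"

definition is_mu :: "(nat \<Rightarrow> nat option) \<Rightarrow> nat \<Rightarrow> nat \<Rightarrow> bool" where
  "is_mu f a n \<longleftrightarrow> f (prod_encode (a, n)) = Some 0 \<and>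
     (\<forall>m<n. \<exists>v. f (prod_encode (a, m)) = Some (Suc v))"

definition minimisation :: "(nat \<Rightarrow> nat option) \<Rightarrow> nat \<Rightarrow> nat option" where
  "minimisation f a = (if \<exists>n. is_mu f a n then Some (LEAST n. is_mu f a n) else None)"

inductive partial_recursive :: "(nat \<Rightarrow> nat option) \<Rightarrow> bool" where
  zero: "partial_recursive (\<lambda>_. Some 0)"
| succ: "partial_recursive (\<lambda>n. Some (Suc n))"
| left: "partial_recursive (\<lambda>n. Some (fst (prod_decode n)))"
| right: "partial_recursive (\<lambda>n. Some (snd (prod_decode n)))"
| pair: "partial_recursive f \<Longrightarrow> partial_recursive g \<Longrightarrow>
    partial_recursive (\<lambda>n. Option.bind (f n) (\<lambda>x. Option.bind (g n) (\<lambda>y. Some (prod_encode (x, y)))))"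
| comp: "partial_recursive f \<Longrightarrow> partial_recursive g \<Longrightarrow>
    partial_recursive (\<lambda>n. Option.bind (g n) f)"
| prec: "partial_recursive f \<Longrightarrow> partial_recursive g \<Longrightarrow>
    partial_recursive (\<lambda>n. prim_recursion f g (fst (prod_decode n)) (snd (prod_decode n)))"
| mu: "partial_recursive f \<Longrightarrow> partial_recursive (minimisation f)"

definition computable_nat :: "(nat \<Rightarrow> nat) \<Rightarrow> bool" where
  "computable_nat f \<longleftrightarrow> partial_recursive (\<lambda>n. Some (f n))"

text \<open>Bijective base-2 numeration, least significant digit first.\<close>

primrec str_code :: "bool list \<Rightarrow> nat" where
  "str_code [] = 0"
| "str_code (b # s) = 2 * str_code s + (if b then 2 else 1)"

lemma bij_str_code: "bij str_code"
proof (rule bijI)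
  show "inj str_code"
  proof (rule injI)
    fix s t show "str_code s = str_code t \<Longrightarrow> s = t"
    proof (induction s arbitrary: t)
      case Nil
      then show ?case by (cases t) (auto split: if_splits)
    next
      case (Cons b s)
      then obtain c u where t: "t = c # u" by (cases t) (auto split: if_splits)
      have "b = c \<and> str_code s = str_code u"
        using Cons.prems unfolding t by (cases b; cases c; simp; presburger)
      then show ?case using Cons.IH t by simp
    qed
  qed
  have "\<exists>s. n = str_code s" for n
  proof (induction n rule: less_induct)
    case (less n)
    show ?case
    proof (cases "n = 0")
      case True
      then show ?thesis by (metis str_code.simps(1))
    next
      case False
      then have "(n - 1) div 2 < n" by linarith
      then obtain s where "(n - 1) div 2 = str_code s" using less by blast
      with False have "n = str_code (even n # s)"
        by (cases "even n"; simp; presburger)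
      then show ?thesis by blast
    qed
  qed
  then show "surj str_code" by (auto simp: surj_def)
qed

definition partial_computable :: "(bool list \<Rightarrow> bool list option) \<Rightarrow> bool" where
  "partial_computable g \<longleftrightarrow>
     (\<exists>h. partial_recursive h \<and> (\<forall>s. h (str_code s) = map_option str_code (g s)))"

definition total_computable :: "(bool list \<Rightarrow> bool list option) \<Rightarrow> bool" where
  "total_computable g \<longleftrightarrow> partial_computable g \<and> (\<forall>s. g s \<noteq> None)"

definition optimal_machine :: "(bool list \<Rightarrow> bool list option) \<Rightarrow> bool" where
  "optimal_machine U \<longleftrightarrow> partial_computable U \<and>
     (\<forall>M. partial_computable M \<longrightarrow>
        (\<exists>c. \<forall>p s. M p = Some s \<longrightarrow> (\<exists>q. U q = Some s \<and> length q \<le> length p + c)))"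

definition plain_complexity :: "(bool list \<Rightarrow> bool list option) \<Rightarrow> bool list \<Rightarrow> nat" where
  "plain_complexity U s = (LEAST l. \<exists>p. U p = Some s \<and> length p = l)"

definition computable_real :: "real \<Rightarrow> bool" where
  "computable_real x \<longleftrightarrow>
     (\<exists>a b. computable_nat a \<and> computable_nat b \<and>
        (\<forall>n. \<bar>x - of_int (int_decode (a n)) / of_nat (Suc (b n))\<bar> \<le> 1 / 2 ^ n))"

definition extracts :: "(bool list \<Rightarrow> bool list option) \<Rightarrow> nat \<Rightarrow> real \<Rightarrow> real \<Rightarrow>
    (nat \<Rightarrow> nat) \<Rightarrow> (nat \<Rightarrow> bool list \<Rightarrow> bool list option) \<Rightarrow> nat \<Rightarrow> bool" where
  "extracts U k \<alpha> \<beta> f \<Gamma> d \<longleftrightarrow>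
     (\<forall>n \<sigma>. length \<sigma> = f n \<longrightarrow>
        (\<forall>i\<in>{1..k}. \<forall>\<tau>. \<Gamma> i \<sigma> = Some \<tau> \<longrightarrow> length \<tau> = n) \<and>
        (real (plain_complexity U \<sigma>) \<ge> \<alpha> * real (length \<sigma>) + real d \<longrightarrow>
          (\<exists>i\<in>{1..k}. \<exists>\<tau>. \<Gamma> i \<sigma> = Some \<tau> \<and>
             real (plain_complexity U \<tau>) \<ge> \<beta> * real (length \<tau>) - real d)))"

definition EXTp :: "(bool list \<Rightarrow> bool list option) \<Rightarrow> nat \<Rightarrow> (real \<times> real) set" where
  "EXTp U k = {(\<alpha>, \<beta>). \<alpha> \<in> {0..1} \<and> \<beta> \<in> {0..1} \<and>
     (\<exists>f \<Gamma> d. inj f \<and> computable_nat f \<and> (\<forall>i\<in>{1..k}. partial_computable (\<Gamma> i)) \<and>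
        extracts U k \<alpha> \<beta> f \<Gamma> d)}"

definition EXT :: "(bool list \<Rightarrow> bool list option) \<Rightarrow> nat \<Rightarrow> (real \<times> real) set" where
  "EXT U k = {(\<alpha>, \<beta>). \<alpha> \<in> {0..1} \<and> \<beta> \<in> {0..1} \<and>
     (\<exists>f \<Gamma> d. inj f \<and> computable_nat f \<and> (\<forall>i\<in>{1..k}. total_computable (\<Gamma> i)) \<and>
        extracts U k \<alpha> \<beta> f \<Gamma> d)}"

end

theory Submission
  imports Defs
begin

text \<open>
  Suppose \<open>f\<close> and \<open>\<Gamma>\<^sub>1, \<dots>, \<Gamma>\<^sub>k\<close> witness \<open>(\<alpha>, \<beta>) \<in> EXTp U k\<close>, and write \<open>m = f n\<close>.

  An input of length \<open>m\<close> and complexity about \<open>\<alpha> m\<close> has an output of complexity at least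
  \<open>\<beta> n - O(1)\<close>, and outputs are not more complex than inputs; so \<open>\<beta> n \<le> \<alpha> m + O(log n)\<close>.

  Conversely, an adversary builds a set \<open>B\<close> of about \<open>2 ^ (\<beta> n)\<close> strings of length \<open>n\<close> that, being
  found effectively, all have complexity below \<open>\<beta> n - d\<close>. Whenever a substantial part of the inputs
  caught so far has a further \<open>\<Gamma>\<^sub>i\<close> defined, the most popular values of \<open>\<Gamma>\<^sub>i\<close> are added to \<open>B\<close>,
  which keeps a fraction of about \<open>2 ^ (\<beta> n - n)\<close> of the caught inputs. After at most \<open>k\<close> rounds
  there remain about \<open>2 ^ (m - k (1 - \<beta>) n)\<close> inputs all of whose defined outputs lie in \<open>B\<close>. Each
  of these has complexity below \<open>\<alpha> m + d\<close>, and counting gives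
  \<open>(1 - \<alpha>) m \<le> k (1 - \<beta>) n + O(log n)\<close>. Only the set of indices \<open>i\<close> that are used is needed as
  advice, so the partiality of the \<open>\<Gamma>\<^sub>i\<close> does no harm.

  For \<open>\<beta> = k \<alpha> / (1 + (k - 1) \<alpha>)\<close> the two bounds have the same slope and pin \<open>m / n\<close> down to
  \<open>\<beta> / \<alpha> = k - (k - 1) \<beta>\<close> up to an error \<open>O(log n / n)\<close>. Since \<open>f\<close> is computable, so is \<open>\<beta>\<close>.
\<close>

subsection \<open>Computable functions\<close>

abbreviation pair_code :: "nat \<Rightarrow> nat \<Rightarrow> nat" (\<open>\<langle>_,/ _\<rangle>\<close>) where
  "\<langle>x, y\<rangle> \<equiv> prod_encode (x, y)"

abbreviation proj1 :: "nat \<Rightarrow> nat" where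
  "proj1 p \<equiv> fst (prod_decode p)"

abbreviation proj2 :: "nat \<Rightarrow> nat" where
  "proj2 p \<equiv> snd (prod_decode p)"

named_theorems computability_intros

lemma computable_nat_comp:
  "computable_nat f \<Longrightarrow> computable_nat g \<Longrightarrow> computable_nat (\<lambda>x. f (g x))"
  unfolding computable_nat_def by (drule (1) partial_recursive.comp) simp

lemma computable_nat_pair [computability_intros]:
  "computable_nat f \<Longrightarrow> computable_nat g \<Longrightarrow> computable_nat (\<lambda>x. \<langle>f x, g x\<rangle>)"
  unfolding computable_nat_def by (drule (1) partial_recursive.pair) simp

lemma computable_nat_proj1 [computability_intros]:
  "computable_nat f \<Longrightarrow> computable_nat (\<lambda>x. proj1 (f x))"
  by (rule computable_nat_comp[of proj1]) (simp_all add: computable_nat_def partial_recursive.left)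

lemma computable_nat_proj2 [computability_intros]:
  "computable_nat f \<Longrightarrow> computable_nat (\<lambda>x. proj2 (f x))"
  by (rule computable_nat_comp[of proj2]) (simp_all add: computable_nat_def partial_recursive.right)

lemma computable_nat_Suc [computability_intros]:
  "computable_nat f \<Longrightarrow> computable_nat (\<lambda>x. Suc (f x))"
  by (rule computable_nat_comp[of Suc]) (simp_all add: computable_nat_def partial_recursive.succ)

lemma computable_nat_id [computability_intros]: "computable_nat (\<lambda>x. x)"
  using partial_recursive.pair[OF partial_recursive.left partial_recursive.right]
  by (simp add: computable_nat_def)

lemma computable_nat_const [computability_intros]: "computable_nat (\<lambda>x. c)"
proof (induction c)
  case 0
  show ?case unfolding computable_nat_def by (rule partial_recursive.zero)
next
  case (Suc c)
  then show ?case by (rule computable_nat_Suc)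
qed

lemma computable_nat_primrec:
  assumes "computable_nat f" "\<And>a. F a 0 = f a"
    and "computable_nat (\<lambda>p. G (proj1 p) (proj1 (proj2 p)) (proj2 (proj2 p)))"
    and "\<And>a n. F a (Suc n) = G a n (F a n)"
    and "computable_nat u" "computable_nat v"
  shows "computable_nat (\<lambda>x. F (u x) (v x))"
proof -
  let ?G = "\<lambda>p. G (proj1 p) (proj1 (proj2 p)) (proj2 (proj2 p))"
  have "prim_recursion (\<lambda>a. Some (f a)) (\<lambda>p. Some (?G p)) a n = Some (F a n)" for a n
    by (induction n) (simp_all add: assms(2,4))
  then have "computable_nat (\<lambda>p. F (proj1 p) (proj2 p))"
    using partial_recursive.prec[of "\<lambda>a. Some (f a)" "\<lambda>p. Some (?G p)"] assms(1,3)
    by (simp add: computable_nat_def)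
  from computable_nat_comp[OF this computable_nat_pair[OF assms(5,6)]] show ?thesis
    by simp
qed

lemma computable_nat_add [computability_intros]:
  "computable_nat f \<Longrightarrow> computable_nat g \<Longrightarrow> computable_nat (\<lambda>x. f x + g x)"
  by (rule computable_nat_primrec[where F = "(+)" and f = "\<lambda>a. a" and G = "\<lambda>a n r. Suc r"])
    (auto intro!: computability_intros)

lemma computable_nat_mult [computability_intros]:
  "computable_nat f \<Longrightarrow> computable_nat g \<Longrightarrow> computable_nat (\<lambda>x. f x * g x)"
  by (rule computable_nat_primrec[where F = "(*)" and f = "\<lambda>a. 0" and G = "\<lambda>a n r. a + r"])
    (auto intro!: computability_intros)

lemma computable_nat_power [computability_intros]:
  "computable_nat f \<Longrightarrow> computable_nat g \<Longrightarrow> computable_nat (\<lambda>x. f x ^ g x)"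
  by (rule computable_nat_primrec[where F = "(^)" and f = "\<lambda>a. 1" and G = "\<lambda>a n r. a * r"])
    (auto intro!: computability_intros)

lemma computable_nat_pred: "computable_nat f \<Longrightarrow> computable_nat (\<lambda>x. f x - 1)"
  by (rule computable_nat_primrec[where F = "\<lambda>_ n. n - 1" and f = "\<lambda>a. 0" and G = "\<lambda>a n r. n"
        and u = "\<lambda>x. x"])
    (auto intro!: computability_intros)

lemma computable_nat_diff [computability_intros]:
  "computable_nat f \<Longrightarrow> computable_nat g \<Longrightarrow> computable_nat (\<lambda>x. f x - g x)"
  by (rule computable_nat_primrec[where F = "(-)" and f = "\<lambda>a. a" and G = "\<lambda>a n r. r - 1"])
    (auto intro!: computability_intros computable_nat_pred simp del: One_nat_def)

text \<open>No length is stored: every number codes an infinite sequence.\<close>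

definition seq_nth :: "nat \<Rightarrow> nat \<Rightarrow> nat" where
  "seq_nth s j = proj1 ((proj2 ^^ j) s)"

lemma computable_nat_seq_nth [computability_intros]:
  assumes "computable_nat f" "computable_nat g"
  shows "computable_nat (\<lambda>x. seq_nth (f x) (g x))"
proof -
  have "computable_nat (\<lambda>x. (proj2 ^^ g x) (f x))"
    by (rule computable_nat_primrec[where F = "\<lambda>s j. (proj2 ^^ j) s" and f = "\<lambda>s. s"
          and G = "\<lambda>s j r. proj2 r"])
      (auto intro!: computability_intros assms)
  then show ?thesis
    unfolding seq_nth_def by (rule computable_nat_proj1)
qed

lemma seq_nth_0 [simp]: "seq_nth s 0 = proj1 s"
  by (simp add: seq_nth_def)

lemma seq_nth_Suc [simp]: "seq_nth s (Suc j) = seq_nth (proj2 s) j"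
  unfolding seq_nth_def funpow_Suc_right comp_apply ..

lemma ex_seq_nth: "\<exists>s. \<forall>j<J. seq_nth s j = b j"
proof (induction J arbitrary: b)
  case (Suc J)
  obtain s where s: "\<forall>j<J. seq_nth s j = b (Suc j)"
    using Suc[of "\<lambda>j. b (Suc j)"] by blast
  have "seq_nth \<langle>b 0, s\<rangle> j = b j" if "j < Suc J" for j
    using that s by (cases j) simp_all
  then show ?case by blast
qed simp

subsection \<open>Decidable and semidecidable predicates\<close>

definition decidable :: "(nat \<Rightarrow> bool) \<Rightarrow> bool" where
  "decidable P \<longleftrightarrow> computable_nat (\<lambda>x. of_bool (P x))"

lemma decidable_le [computability_intros]:
  assumes "computable_nat f" "computable_nat g"
  shows "decidable (\<lambda>x. f x \<le> g x)"
proof -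
  have "of_bool (f x \<le> g x) = 1 - (f x - g x)" for x by simp
  then show ?thesis
    unfolding decidable_def by (simp only:) (intro computability_intros assms)
qed

lemma decidable_not [computability_intros]:
  assumes "decidable P"
  shows "decidable (\<lambda>x. \<not> P x)"
proof -
  have "of_bool (\<not> P x) = 1 - (of_bool (P x) :: nat)" for x by simp
  then show ?thesis
    using assms unfolding decidable_def by (simp only:) (intro computability_intros)
qed

lemma decidable_conj [computability_intros]:
  assumes "decidable P" "decidable Q"
  shows "decidable (\<lambda>x. P x \<and> Q x)"
proof -
  have "of_bool (P x \<and> Q x) = of_bool (P x) * (of_bool (Q x) :: nat)" for x by simp
  then show ?thesis
    using assms unfolding decidable_def by (simp only:) (intro computability_intros)
qed

lemma decidable_eq [computability_intros]:
  "computable_nat f \<Longrightarrow> computable_nat g \<Longrightarrow> decidable (\<lambda>x. f x = g x)"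
  unfolding order_eq_iff[of "f _"] by (intro computability_intros)

lemma decidable_comp: "decidable P \<Longrightarrow> computable_nat f \<Longrightarrow> decidable (\<lambda>x. P (f x))"
  unfolding decidable_def by (rule computable_nat_comp)

abbreviation decidable2 :: "(nat \<Rightarrow> nat \<Rightarrow> bool) \<Rightarrow> bool" where
  "decidable2 R \<equiv> decidable (\<lambda>p. R (proj1 p) (proj2 p))"

lemma decidable_comp2:
  assumes "decidable2 R" "computable_nat f" "computable_nat g"
  shows "decidable (\<lambda>x. R (f x) (g x))"
  using decidable_comp[OF assms(1) computable_nat_pair[OF assms(2,3)]] by simp

lemma decidable_all_less [computability_intros]:
  assumes P: "decidable2 P" and g: "computable_nat g"
  shows "decidable (\<lambda>x. \<forall>j<g x. P x j)"
proof -
  have "computable_nat (\<lambda>p. of_bool (P (proj1 p) (proj1 (proj2 p))) * proj2 (proj2 p))"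
    by (intro computability_intros decidable_comp2[OF P, unfolded decidable_def])
  then show ?thesis
    unfolding decidable_def
    by (rule computable_nat_primrec[where F = "\<lambda>x n. of_bool (\<forall>j<n. P x j)" and f = "\<lambda>x. 1"
          and G = "\<lambda>x n r. of_bool (P x n) * r" and u = "\<lambda>x. x", rotated 2])
      (auto intro!: computability_intros g simp: All_less_Suc)
qed

definition semidecidable :: "(nat \<Rightarrow> bool) \<Rightarrow> bool" where
  "semidecidable P \<longleftrightarrow> (\<exists>R. decidable2 R \<and> (\<forall>x. P x \<longleftrightarrow> (\<exists>t. R x t)))"

abbreviation semidecidable2 :: "(nat \<Rightarrow> nat \<Rightarrow> bool) \<Rightarrow> bool" where
  "semidecidable2 P \<equiv> semidecidable (\<lambda>p. P (proj1 p) (proj2 p))"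

abbreviation semidecidable3 :: "(nat \<Rightarrow> nat \<Rightarrow> nat \<Rightarrow> bool) \<Rightarrow> bool" where
  "semidecidable3 P \<equiv> semidecidable (\<lambda>p. P (proj1 p) (proj1 (proj2 p)) (proj2 (proj2 p)))"

lemma semidecidableI:
  "(\<And>x. P x \<longleftrightarrow> (\<exists>t. R x t)) \<Longrightarrow> decidable2 R \<Longrightarrow> semidecidable P"
  unfolding semidecidable_def by blast

lemma semidecidableE:
  assumes "semidecidable P"
  obtains R where "\<And>x. P x \<longleftrightarrow> (\<exists>t. R x t)" "decidable2 R"
  using assms unfolding semidecidable_def by blast

lemma semidecidableE2:
  assumes "semidecidable2 P"
  obtains R where "\<And>x y. P x y \<longleftrightarrow> (\<exists>t. R x \<langle>y, t\<rangle>)" "decidable2 R"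
proof (rule semidecidableE[OF assms])
  fix R assume R: "\<And>p. P (proj1 p) (proj2 p) \<longleftrightarrow> (\<exists>t. R p t)"
    and dec: "decidable2 R"
  have "P x y \<longleftrightarrow> (\<exists>t. R \<langle>x, proj1 \<langle>y, t\<rangle>\<rangle> (proj2 \<langle>y, t\<rangle>))" for x y
    using R[of "\<langle>x, y\<rangle>"] by simp
  then show thesis
    by (rule that) (intro decidable_comp2[OF dec] computability_intros)
qed

lemma decidable_imp_semidecidable:
  assumes "decidable P"
  shows "semidecidable P"
  by (rule semidecidableI[of _ "\<lambda>x t. P x"])
    (simp, intro decidable_comp[OF assms] computability_intros)

lemmas semidecidable_le [computability_intros] = decidable_imp_semidecidable[OF decidable_le]
  and semidecidable_eq [computability_intros] = decidable_imp_semidecidable[OF decidable_eq]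

lemma semidecidable_less [computability_intros]:
  "computable_nat f \<Longrightarrow> computable_nat g \<Longrightarrow> semidecidable (\<lambda>x. f x < g x)"
  unfolding less_eq_Suc_le by (intro computability_intros)

lemma semidecidable_comp:
  assumes "semidecidable P" "computable_nat f"
  shows "semidecidable (\<lambda>x. P (f x))"
proof -
  obtain R where "\<And>x. P x \<longleftrightarrow> (\<exists>t. R x t)" and R: "decidable2 R"
    using assms(1) by (rule semidecidableE) blast
  then show ?thesis
    by (intro semidecidableI[of _ "\<lambda>x. R (f x)"])
      (auto intro!: decidable_comp2[OF R] computability_intros computable_nat_comp[OF assms(2)])
qed

lemma semidecidable_comp2:
  assumes "semidecidable2 P" "computable_nat f" "computable_nat g"
  shows "semidecidable (\<lambda>x. P (f x) (g x))"
  using semidecidable_comp[OF assms(1) computable_nat_pair[OF assms(2,3)]] by simp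

lemma semidecidable_comp3:
  assumes "semidecidable3 P"
    and "computable_nat f" "computable_nat g" "computable_nat h"
  shows "semidecidable (\<lambda>x. P (f x) (g x) (h x))"
  using semidecidable_comp[OF assms(1) 
      computable_nat_pair[OF assms(2) computable_nat_pair[OF assms(3,4)]]]
  by simp

lemma semidecidable_conj [computability_intros]:
  assumes "semidecidable P" "semidecidable Q"
  shows "semidecidable (\<lambda>x. P x \<and> Q x)"
proof -
  obtain R where P: "\<And>x. P x \<longleftrightarrow> (\<exists>t. R x t)" and R: "decidable2 R"
    using assms(1) by (rule semidecidableE) blast
  obtain R' where Q: "\<And>x. Q x \<longleftrightarrow> (\<exists>t. R' x t)" and R': "decidable2 R'"
    using assms(2) by (rule semidecidableE) blast
  show ?thesis
  proof (rule semidecidableI)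
    show "P x \<and> Q x \<longleftrightarrow> (\<exists>t. R x (proj1 t) \<and> R' x (proj2 t))" for x
      unfolding P Q by (metis prod_encode_inverse fst_conv snd_conv)
    show "decidable (\<lambda>p. R (proj1 p) (proj1 (proj2 p)) \<and> R' (proj1 p) (proj2 (proj2 p)))"
      by (intro decidable_conj decidable_comp2[OF R] decidable_comp2[OF R'] computability_intros)
  qed
qed

lemma semidecidable_ex [computability_intros]:
  assumes "semidecidable2 P"
  shows "semidecidable (\<lambda>x. \<exists>y. P x y)"
proof (rule semidecidableE2[OF assms])
  fix R assume P: "\<And>x y. P x y \<longleftrightarrow> (\<exists>t. R x \<langle>y, t\<rangle>)" and R: "decidable2 R"
  show ?thesis
  proof (rule semidecidableI[OF _ R])
    show "(\<exists>y. P x y) \<longleftrightarrow> (\<exists>w. R x w)" for x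
      unfolding P by (metis prod_decode_inverse prod.exhaust)
  qed
qed

lemma semidecidable_all_less [computability_intros]:
  assumes "semidecidable2 P" and g: "computable_nat g"
  shows "semidecidable (\<lambda>x. \<forall>j<g x. P x j)"
proof (rule semidecidableE2[OF assms(1)])
  fix R assume P: "\<And>x y. P x y \<longleftrightarrow> (\<exists>t. R x \<langle>y, t\<rangle>)" and R: "decidable2 R"
  show ?thesis
  proof (rule semidecidableI)
    show "(\<forall>j<g x. P x j) \<longleftrightarrow> (\<exists>s. \<forall>j<g x. R x \<langle>j, seq_nth s j\<rangle>)" for x
    proof
      assume "\<forall>j<g x. P x j"
      then obtain b where b: "\<forall>j<g x. R x \<langle>j, b j\<rangle>" unfolding P by metis
      obtain s where "\<forall>j<g x. seq_nth s j = b j" using ex_seq_nth[of "g x" b] by blast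
      with b have "\<forall>j<g x. R x \<langle>j, seq_nth s j\<rangle>" by simp
      then show "\<exists>s. \<forall>j<g x. R x \<langle>j, seq_nth s j\<rangle>" ..
    qed (auto simp: P)
    show "decidable (\<lambda>p. \<forall>j<g (proj1 p). R (proj1 p) \<langle>j, seq_nth (proj2 p) j\<rangle>)"
      by (intro decidable_all_less decidable_comp2[OF R] computability_intros
          computable_nat_comp[OF g])
  qed
qed

lemma semidecidable_ball_finite:
  assumes "finite S" "\<And>i. i \<in> S \<Longrightarrow> semidecidable (P i)"
  shows "semidecidable (\<lambda>x. \<forall>i\<in>S. P i x)"
  using assms
proof (induction S)
  case empty
  show ?case
    using semidecidable_eq[OF computable_nat_id computable_nat_id] by simp
next
  case (insert i S)
  then show ?case using semidecidable_conj[of "P i" "\<lambda>x. \<forall>i\<in>S. P i x"] by simp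
qed

subsection \<open>Graphs of partial recursive functions\<close>

lemma prim_recursion_eq_Some_iff:
  "prim_recursion f g a n = Some y \<longleftrightarrow>
    (\<exists>s. f a = Some (seq_nth s 0) \<and>
      (\<forall>i<n. g \<langle>a, \<langle>i, seq_nth s i\<rangle>\<rangle> = Some (seq_nth s (Suc i))) \<and> seq_nth s n = y)"
    (is "_ \<longleftrightarrow> (\<exists>s. ?Run s)")
proof
  assume y: "prim_recursion f g a n = Some y"
  have defined: "prim_recursion f g a i \<noteq> None" if "i \<le> n" for i
    using that by (induction rule: inc_induct) (use y in \<open>auto simp: bind_eq_Some_conv\<close>)
  obtain s where s: "\<forall>i<Suc n. seq_nth s i = the (prim_recursion f g a i)"
    using ex_seq_nth[of "Suc n" "\<lambda>i. the (prim_recursion f g a i)"] by blast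
  then have run: "prim_recursion f g a i = Some (seq_nth s i)" if "i \<le> n" for i
    using defined[OF that] that by auto
  have "g \<langle>a, \<langle>i, seq_nth s i\<rangle>\<rangle> = Some (seq_nth s (Suc i))" if "i < n" for i
    using run[of i] run[of "Suc i"] that by simp
  then have "?Run s" using run[of 0] run[of n] y by simp
  then show "\<exists>s. ?Run s" by blast
next
  assume "\<exists>s. ?Run s"
  then obtain s where s: "?Run s" by blast
  have "prim_recursion f g a i = Some (seq_nth s i)" if "i \<le> n" for i
    using that s by (induction i) auto
  with s show "prim_recursion f g a n = Some y" by blast
qed

lemma is_mu_unique: "is_mu f a n \<Longrightarrow> is_mu f a n' \<Longrightarrow> n = n'"
  unfolding is_mu_def by (metis linorder_neqE_nat nat.distinct(1) option.inject)

lemma minimisation_eq_Some_iff: "minimisation f a = Some n \<longleftrightarrow> is_mu f a n"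
proof
  show "is_mu f a n" if "minimisation f a = Some n"
    using that unfolding minimisation_def by (auto split: if_splits intro: LeastI)
next
  assume mu: "is_mu f a n"
  then have "(LEAST n. is_mu f a n) = n" by (intro Least_equality) (auto dest: is_mu_unique[OF mu])
  then show "minimisation f a = Some n" unfolding minimisation_def using mu by auto
qed

lemma semidecidable_graph:
  assumes "partial_recursive h" "computable_nat u" "computable_nat v"
  shows "semidecidable (\<lambda>x. h (u x) = Some (v x))"
  using assms
proof (induction arbitrary: u v)
  case zero
  then show ?case by (simp, intro computability_intros)
next
  case succ
  then show ?case by (simp, intro computability_intros)
next
  case left
  then show ?case by (simp, intro computability_intros)
next
  case right
  then show ?case by (simp, intro computability_intros)
next
  case (pair f g)
  have "Option.bind (f x) (\<lambda>y. Option.bind (g x) (\<lambda>z. Some \<langle>y, z\<rangle>)) = Some w \<longleftrightarrow>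
      f x = Some (proj1 w) \<and> g x = Some (proj2 w)" for x w
    by (auto simp: bind_eq_Some_conv)
  then show ?case by (simp only:) (intro computability_intros pair)
next
  case (comp f g)
  show ?case
    unfolding bind_eq_Some_conv
    by (intro computability_intros comp.IH comp.prems[THEN computable_nat_comp])
next
  case (prec f g)
  show ?case
    unfolding prim_recursion_eq_Some_iff
    by (intro computability_intros prec.IH prec.prems[THEN computable_nat_comp])
next
  case (mu f)
  show ?case
    unfolding minimisation_eq_Some_iff is_mu_def
    by (intro computability_intros mu.IH mu.prems[THEN computable_nat_comp])
qed

lemma semidecidable_uniformization:
  assumes "semidecidable2 P"
  obtains h where "partial_recursive h" "\<And>x y. h x = Some y \<Longrightarrow> P x y" "\<And>x y. P x y \<Longrightarrow> h x \<noteq> None"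
proof -
  obtain T where P: "\<And>x y. P x y \<longleftrightarrow> (\<exists>t. T x \<langle>y, t\<rangle>)"
    and T: "decidable2 T"
    using assms by (rule semidecidableE2) blast
  have P_iff: "P x y \<longleftrightarrow> (\<exists>w. T x w \<and> proj1 w = y)" for x y
    unfolding P by (metis prod_decode_inverse prod_encode_inverse fst_conv prod.collapse)
  define f where "f p = Some (of_bool (\<not> T (proj1 p) (proj2 p)) :: nat)" for p
  define h where "h x = Option.bind (minimisation f x) (\<lambda>w. Some (proj1 w))" for x
  have "partial_recursive f"
    unfolding f_def computable_nat_def[symmetric] decidable_def[symmetric]
    by (rule decidable_not[OF T])
  then have "partial_recursive h"
    unfolding h_def by (intro partial_recursive.comp partial_recursive.mu partial_recursive.left)
  have mu_iff: "is_mu f x w \<longleftrightarrow> T x w \<and> (\<forall>w'<w. \<not> T x w')" for x w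
    unfolding is_mu_def f_def by auto
  have "P x y" if "h x = Some y" for x y
    using that unfolding h_def P_iff
    by (auto simp: bind_eq_Some_conv minimisation_eq_Some_iff mu_iff)
  moreover have "h x \<noteq> None" if "P x y" for x y
  proof -
    have "\<exists>w. is_mu f x w"
      using that unfolding P_iff mu_iff by (metis exists_least_iff)
    then show ?thesis unfolding h_def minimisation_def by auto
  qed
  ultimately show thesis using that \<open>partial_recursive h\<close> by blast
qed

lemma computable_nat_if_graph:
  assumes "semidecidable2 (\<lambda>x y. f x = y)"
  shows "computable_nat f"
proof -
  obtain h where "partial_recursive h"
    and h: "\<And>x y. h x = Some y \<Longrightarrow> f x = y" "\<And>x y. f x = y \<Longrightarrow> h x \<noteq> None"
    using assms by (rule semidecidable_uniformization) blast
  have "h = (\<lambda>x. Some (f x))"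
  proof
    show "h x = Some (f x)" for x using h[of x] by (metis option.exhaust)
  qed
  with \<open>partial_recursive h\<close> show ?thesis unfolding computable_nat_def by blast
qed

subsection \<open>Computability on strings\<close>

definition str_decode :: "nat \<Rightarrow> bool list" where
  "str_decode = inv str_code"

lemma str_decode_str_code [simp]: "str_decode (str_code s) = s"
  unfolding str_decode_def using bij_str_code by (simp add: bij_is_inj inv_f_f)

lemma str_code_str_decode [simp]: "str_code (str_decode x) = x"
  unfolding str_decode_def using bij_str_code by (simp add: bij_is_surj surj_f_inv_f)

lemma str_decode_eq_iff: "str_decode x = s \<longleftrightarrow> x = str_code s"
  by auto

lemma ex_str_decode: "(\<exists>s. P s) \<longleftrightarrow> (\<exists>x. P (str_decode x))"
  by (metis str_decode_str_code)

lemma str_code_bounds: "2 ^ length s \<le> Suc (str_code s)" "Suc (str_code s) < 2 ^ Suc (length s)"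
  by (induction s) auto

lemma length_eq_iff_str_code:
  "length s = l \<longleftrightarrow> 2 ^ l \<le> Suc (str_code s) \<and> Suc (str_code s) < 2 ^ Suc l"
proof
  assume "2 ^ l \<le> Suc (str_code s) \<and> Suc (str_code s) < 2 ^ Suc l"
  then have "(2::nat) ^ length s < 2 ^ Suc l" "(2::nat) ^ l < 2 ^ Suc (length s)"
    using str_code_bounds[of s] by linarith+
  then have "length s < Suc l" "l < Suc (length s)"
    by (simp_all del: power_Suc)
  then show "length s = l" by simp
qed (use str_code_bounds in blast)

lemma length_str_decode: "j < 2 ^ l \<Longrightarrow> length (str_decode (2 ^ l - 1 + j)) = l"
  by (simp add: length_eq_iff_str_code)

lemma str_code_replicate_False_True:
  "Suc (str_code (replicate e False @ True # s)) = 2 ^ e * (2 * str_code s + 3)"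
  by (induction e) simp_all

lemma replicate_False_True_inject:
  "replicate e False @ True # s = replicate e' False @ True # s' \<longleftrightarrow> e = e' \<and> s = s'"
proof (induction e arbitrary: e')
  case 0
  then show ?case by (cases e') auto
next
  case (Suc e)
  then show ?case by (cases e') auto
qed

lemma str_code_append_replicate_False:
  "str_code (s @ replicate r False) + 2 ^ length s = str_code s + 2 ^ (length s + r)"
proof (induction s)
  case Nil
  show ?case by (induction r) simp_all
qed simp

abbreviation strings :: "nat \<Rightarrow> bool list set" where
  "strings l \<equiv> {s. length s = l}"

lemma finite_strings: "finite (strings l)"
  using finite_lists_length_eq[of "UNIV :: bool set"] by simp

lemma card_strings: "card (strings l) = 2 ^ l"
  using card_lists_length_eq[of "UNIV :: bool set"] by simp

lemma computable_nat_length [computability_intros]: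
  assumes "computable_nat f"
  shows "computable_nat (\<lambda>x. length (str_decode (f x)))"
proof (rule computable_nat_comp[OF computable_nat_if_graph assms])
  show "semidecidable2 (\<lambda>x l. length (str_decode x) = l)"
    unfolding length_eq_iff_str_code str_code_str_decode by (intro computability_intros)
qed

lemma semidecidable_string_graph:
  assumes "partial_computable M" "computable_nat f" "computable_nat g"
  shows "semidecidable (\<lambda>x. M (str_decode (f x)) = Some (str_decode (g x)))"
proof -
  obtain h where h: "partial_recursive h" "\<And>s. h (str_code s) = map_option str_code (M s)"
    using assms(1) unfolding partial_computable_def by blast
  have "M (str_decode y) = Some (str_decode z) \<longleftrightarrow> h y = Some z" for y z
    using h(2)[of "str_decode y"] by auto
  then show ?thesis
    using semidecidable_graph[OF h(1) assms(2,3)] by simp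
qed

lemma string_uniformization:
  assumes "semidecidable2 (\<lambda>x y. R (str_decode x) (str_decode y))"
  obtains M where "partial_computable M" "\<And>s t. M s = Some t \<Longrightarrow> R s t" "\<And>s t. R s t \<Longrightarrow> M s \<noteq> None"
proof (rule semidecidable_uniformization[OF assms])
  fix h assume h: "partial_recursive h"
    and sound: "\<And>x y. h x = Some y \<Longrightarrow> R (str_decode x) (str_decode y)"
    and complete: "\<And>x y. R (str_decode x) (str_decode y) \<Longrightarrow> h x \<noteq> None"
  define M where "M s = map_option str_decode (h (str_code s))" for s
  show thesis
  proof (rule that)
    show "partial_computable M"
      unfolding partial_computable_def M_def
      by (intro exI[of _ h] conjI h) (simp add: option.map_comp comp_def option.map_ident)
    show "R s t" if "M s = Some t" for s t
      using that sound[of "str_code s"] by (auto simp: M_def)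
    show "M s \<noteq> None" if "R s t" for s t
      using that complete[of "str_code s" "str_code t"] by (simp add: M_def)
  qed
qed

definition str_nth :: "nat \<Rightarrow> nat \<Rightarrow> bool list" where
  "str_nth y j = str_decode (seq_nth y j)"

lemma ex_str_nth: "\<exists>y. \<forall>j<J. str_nth y j = b j"
  using ex_seq_nth[of J "\<lambda>j. str_code (b j)"] unfolding str_nth_def
  by (metis str_decode_str_code)

lemma ex_str_nth_superset:
  assumes "finite B" "card B \<le> J"
  shows "\<exists>y. B \<subseteq> str_nth y ` {..<J}"
proof -
  obtain b where b: "bij_betw b {..<card B} B"
    using ex_bij_betw_nat_finite[OF assms(1)] atLeast0LessThan by metis
  obtain y where "\<forall>j<card B. str_nth y j = b j"
    using ex_str_nth[of "card B" b] by blast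
  then have "B = str_nth y ` {..<card B}"
    using b by (auto simp: bij_betw_def image_iff)
  also have "\<dots> \<subseteq> str_nth y ` {..<J}"
    using assms(2) by (intro image_mono) auto
  finally show ?thesis by blast
qed

lemma le_card_iff_str_nth:
  assumes "finite A"
  shows "K \<le> card A \<longleftrightarrow> (\<exists>y. \<forall>j<K. str_nth y j \<in> A \<and> (\<forall>i<j. str_nth y i \<noteq> str_nth y j))"
proof
  assume "K \<le> card A"
  then obtain B where B: "B \<subseteq> A" "card B = K" "finite B"
    using obtain_subset_with_card_n by metis
  obtain b where b: "bij_betw b {..<K} B"
    using ex_bij_betw_nat_finite[OF B(3)] atLeast0LessThan B(2) by metis
  obtain y where y: "\<forall>j<K. str_nth y j = b j"
    using ex_str_nth[of K b] by blast
  have "str_nth y j \<in> A \<and> (\<forall>i<j. str_nth y i \<noteq> str_nth y j)" if "j < K" for j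
    using that y b B(1) by (auto simp: bij_betw_def inj_on_def)
  then show "\<exists>y. \<forall>j<K. str_nth y j \<in> A \<and> (\<forall>i<j. str_nth y i \<noteq> str_nth y j)" by blast
next
  assume "\<exists>y. \<forall>j<K. str_nth y j \<in> A \<and> (\<forall>i<j. str_nth y i \<noteq> str_nth y j)"
  then obtain y where y: "\<forall>j<K. str_nth y j \<in> A \<and> (\<forall>i<j. str_nth y i \<noteq> str_nth y j)" ..
  then have "inj_on (str_nth y) {..<K}"
    by (intro linorder_inj_onI) auto
  moreover have "str_nth y ` {..<K} \<subseteq> A" using y by auto
  ultimately show "K \<le> card A" using card_inj_on_le[OF _ _ assms, of "str_nth y" "{..<K}"] by simp
qed

lemma semidecidable_le_card:
  assumes P: "semidecidable2 (\<lambda>x y. P x (str_decode y))"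
    and K: "computable_nat K" and l: "computable_nat l"
  shows "semidecidable (\<lambda>x. K x \<le> card {s \<in> strings (l x). P x s})"
proof -
  have "finite {s \<in> strings (l x). P x s}" for x
    using finite_strings by simp
  note iff = le_card_iff_str_nth[OF this]
  show ?thesis
    unfolding iff unfolding mem_Collect_eq str_nth_def str_decode_eq_iff str_code_str_decode
    by (intro computability_intros semidecidable_comp2[OF P] decidable_imp_semidecidable
        computable_nat_comp[OF K] computable_nat_comp[OF l])
qed

subsection \<open>Plain complexity\<close>

lemma plain_complexity_le: "U p = Some s \<Longrightarrow> plain_complexity U s \<le> length p"
  unfolding plain_complexity_def by (rule Least_le) blast

lemma plain_complexity_le_machine:
  assumes "optimal_machine U" "partial_computable M"
  obtains c where "\<And>p s. M p = Some s \<Longrightarrow> plain_complexity U s \<le> length p + c"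
proof -
  obtain c where c: "\<And>p s. M p = Some s \<Longrightarrow> \<exists>q. U q = Some s \<and> length q \<le> length p + c"
    using assms unfolding optimal_machine_def by blast
  have "plain_complexity U s \<le> length p + c" if "M p = Some s" for p s
    using c[OF that] plain_complexity_le by (meson le_trans)
  then show thesis by (rule that)
qed

lemma plain_complexity_attained:
  assumes "optimal_machine U"
  obtains p where "U p = Some s" "length p = plain_complexity U s"
proof -
  have "partial_recursive (\<lambda>x. Some x)"
    using computable_nat_id unfolding computable_nat_def .
  then have "partial_computable Some" unfolding partial_computable_def by (intro exI) auto
  then have "\<exists>p. U p = Some s" using assms unfolding optimal_machine_def by blast
  then have "\<exists>l p. U p = Some s \<and> length p = l" by blast
  from LeastI_ex[OF this] show thesis using that unfolding plain_complexity_def by blast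
qed

lemma plain_complexity_image_le:
  assumes U: "optimal_machine U" and M: "partial_computable M"
  obtains c where "\<And>s t. M s = Some t \<Longrightarrow> plain_complexity U t \<le> plain_complexity U s + c"
proof -
  obtain u where u: "partial_recursive u" "\<And>s. u (str_code s) = map_option str_code (U s)"
    using U unfolding optimal_machine_def partial_computable_def by blast
  obtain h where h: "partial_recursive h" "\<And>s. h (str_code s) = map_option str_code (M s)"
    using M unfolding partial_computable_def by blast
  have "Option.bind (u (str_code p)) h = map_option str_code (Option.bind (U p) M)" for p
    by (cases "U p") (simp_all add: u h)
  then have "partial_computable (\<lambda>p. Option.bind (U p) M)"
    unfolding partial_computable_def using partial_recursive.comp[OF h(1) u(1)] by blast
  then obtain c where c: "\<And>p t. Option.bind (U p) M = Some t \<Longrightarrow> plain_complexity U t \<le> length p + c"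
    using plain_complexity_le_machine[OF U] by blast
  have "plain_complexity U t \<le> plain_complexity U s + c" if "M s = Some t" for s t
  proof -
    obtain p where "U p = Some s" "length p = plain_complexity U s"
      using plain_complexity_attained[OF U] .
    with c[of p t] that show ?thesis by simp
  qed
  then show thesis by (rule that)
qed

lemma finite_plain_complexity_less:
  assumes "optimal_machine U"
  shows "finite {s. plain_complexity U s < l}"
    and "card {s. plain_complexity U s < l} < 2 ^ l"
proof -
  let ?programs = "{p :: bool list. length p < l}"
  have programs: "finite ?programs \<and> card ?programs < 2 ^ l"
  proof (induction l)
    case (Suc l)
    have "{p :: bool list. length p < Suc l} = {p. length p < l} \<union> strings l" by auto
    then show ?case
      using Suc card_Un_le[of "{p :: bool list. length p < l}" "strings l"]
      by (simp add: finite_strings card_strings)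
  qed simp
  have sub: "{s. plain_complexity U s < l} \<subseteq> (\<lambda>p. the (U p)) ` ?programs"
  proof
    fix s assume "s \<in> {s. plain_complexity U s < l}"
    moreover obtain p where "U p = Some s" "length p = plain_complexity U s"
      using plain_complexity_attained[OF assms] .
    ultimately show "s \<in> (\<lambda>p. the (U p)) ` ?programs"
      by (intro image_eqI[of _ _ p]) auto
  qed
  then show "finite {s. plain_complexity U s < l}" using programs finite_subset by blast
  show "card {s. plain_complexity U s < l} < 2 ^ l"
    using surj_card_le[OF _ sub] programs by linarith
qed

text \<open>
  The program \<open>0\<^sup>e 1 s\<close> spends \<open>e\<close> bits on the parameter, which is affordable because only output
  lengths \<open>4 ^ e\<close> will matter.
\<close>

lemma ex_plain_complexity_le_parameter:
  assumes U: "optimal_machine U"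
    and R: "semidecidable3 (\<lambda>e x y. R e (str_decode x) (str_decode y))"
  obtains c where "\<And>e s t. R e s t \<Longrightarrow> \<exists>t'. R e s t' \<and> plain_complexity U t' \<le> e + length s + c"
proof -
  define R' where "R' p t \<longleftrightarrow> (\<exists>e s. p = replicate e False @ True # s \<and> R e s t)" for p t
  have R': "R' (replicate e False @ True # s) t \<longleftrightarrow> R e s t" for e s t
    unfolding R'_def replicate_False_True_inject by blast
  have "str_decode x = replicate e False @ True # str_decode y \<longleftrightarrow>
      Suc x = 2 ^ e * (2 * y + 3)" for e x y
    using str_code_replicate_False_True[of e "str_decode y"] by (auto simp: str_decode_eq_iff)
  then have "R' (str_decode x) t \<longleftrightarrow>
      (\<exists>e y. Suc x = 2 ^ e * (2 * y + 3) \<and> R e (str_decode y) t)" for x t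
    unfolding R'_def ex_str_decode by simp
  then have "semidecidable2 (\<lambda>x y. R' (str_decode x) (str_decode y))"
    by (simp only:) (intro computability_intros semidecidable_comp3[OF R])
  then obtain M where M: "partial_computable M" "\<And>p t. M p = Some t \<Longrightarrow> R' p t"
    "\<And>p t. R' p t \<Longrightarrow> M p \<noteq> None"
    by (rule string_uniformization) blast
  obtain c where c: "\<And>p t. M p = Some t \<Longrightarrow> plain_complexity U t \<le> length p + c"
    using plain_complexity_le_machine[OF U M(1)] by blast
  have "\<exists>t'. R e s t' \<and> plain_complexity U t' \<le> e + length s + Suc c" if rel: "R e s t" for e s t
  proof -
    let ?p = "replicate e False @ True # s"
    obtain t' where t': "M ?p = Some t'" using M(3)[of ?p t] rel unfolding R' by blast
    then have "R e s t'" using M(2) R' by blast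
    moreover have "plain_complexity U t' \<le> e + length s + Suc c" using c[OF t'] by simp
    ultimately show ?thesis by blast
  qed
  then show thesis by (rule that)
qed

lemma ex_plain_complexity_between:
  assumes U: "optimal_machine U" and m: "computable_nat m"
  obtains c where "\<And>e l. l \<le> m e \<Longrightarrow>
    \<exists>s. length s = m e \<and> l \<le> plain_complexity U s \<and> plain_complexity U s \<le> e + l + c"
proof -
  define pad where "pad e s = s @ replicate (m e - length s) False" for e s
  define R where "R e s t \<longleftrightarrow> length s \<le> m e \<and> t = pad e s" for e s t
  have R_iff: "R e (str_decode x) (str_decode y) \<longleftrightarrow> length (str_decode x) \<le> m e \<and>
      y + 2 ^ length (str_decode x) = x + 2 ^ m e" for e x y
    using str_code_append_replicate_False[of "str_decode x" "m e - length (str_decode x)"]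
    unfolding R_def pad_def str_decode_eq_iff by auto
  have "semidecidable3 (\<lambda>e x y. R e (str_decode x) (str_decode y))"
    unfolding R_iff by (intro computability_intros computable_nat_comp[OF m])
  then obtain c where "\<And>e s t. R e s t \<Longrightarrow> \<exists>t'. R e s t' \<and> plain_complexity U t' \<le> e + length s + c"
    by (rule ex_plain_complexity_le_parameter[OF U]) blast
  then have c: "plain_complexity U (pad e s) \<le> e + length s + c" if "length s \<le> m e" for e s
    using that unfolding R_def by blast
  have "\<exists>s. length s = m e \<and> l \<le> plain_complexity U s \<and> plain_complexity U s \<le> e + l + c"
    if l: "l \<le> m e" for e l
  proof -
    let ?S = "pad e ` strings l"
    have "inj_on (pad e) (strings l)" by (auto simp: inj_on_def pad_def)
    then have "card ?S = 2 ^ l" by (simp add: card_image card_strings)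
    then have "\<not> ?S \<subseteq> {s. plain_complexity U s < l}"
      using card_mono[OF finite_plain_complexity_less(1)[OF U]]
        finite_plain_complexity_less(2)[OF U]
      by (metis leD)
    then obtain s where "length s = l" "l \<le> plain_complexity U (pad e s)" by fastforce
    then show ?thesis using c[of s e] l by (intro exI[of _ "pad e s"]) (simp add: pad_def)
  qed
  then show thesis by (rule that)
qed

lemma ex_simple_str_nth:
  assumes U: "optimal_machine U"
    and Q: "semidecidable3 Q"
  obtains c where "\<And>e l y. Q e l y \<Longrightarrow>
    \<exists>y'. Q e l y' \<and> (\<forall>j<r * 2 ^ l. plain_complexity U (str_nth y' j) \<le> e + l + c)"
proof -
  have "semidecidable2 (\<lambda>p. Q (proj1 p) (proj2 p))"
    by (intro semidecidable_comp3[OF Q] computability_intros)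
  then obtain Y where Y: "partial_recursive Y" "\<And>e l y. Y \<langle>e, l\<rangle> = Some y \<Longrightarrow> Q e l y"
    "\<And>e l y. Q e l y \<Longrightarrow> Y \<langle>e, l\<rangle> \<noteq> None"
    by (rule semidecidable_uniformization) (metis fst_conv snd_conv prod_encode_inverse)
  define R where "R e s t \<longleftrightarrow> (\<exists>l y. length s = l + r \<and> Y \<langle>e, l\<rangle> = Some y \<and>
      t = str_nth y (Suc (str_code s) - 2 ^ (l + r)))" for e s t
  have "semidecidable3 (\<lambda>e x y. R e (str_decode x) (str_decode y))"
    unfolding R_def str_nth_def str_decode_eq_iff str_code_str_decode
    by (intro computability_intros semidecidable_graph[OF Y(1)])
  then obtain c where c: "\<And>e s t. R e s t \<Longrightarrow>
      \<exists>t'. R e s t' \<and> plain_complexity U t' \<le> e + length s + c"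
    by (rule ex_plain_complexity_le_parameter[OF U]) blast
  have "\<exists>y'. Q e l y' \<and> (\<forall>j<r * 2 ^ l. plain_complexity U (str_nth y' j) \<le> e + l + (r + c))"
    if "Q e l y" for e l y
  proof -
    obtain y' where y': "Y \<langle>e, l\<rangle> = Some y'" using Y(3)[OF \<open>Q e l y\<close>] by blast
    have "plain_complexity U (str_nth y' j) \<le> e + l + (r + c)" if "j < r * 2 ^ l" for j
    proof -
      have "r * 2 ^ l \<le> (2::nat) ^ (l + r)" by (simp add: power_add less_imp_le)
      then have j: "j < 2 ^ (l + r)" using that by linarith
      let ?s = "str_decode (2 ^ (l + r) - 1 + j)"
      have "R e ?s t \<longleftrightarrow> t = str_nth y' j" for t
        unfolding R_def length_str_decode[OF j] using y' by auto
      then show ?thesis using c[of e ?s] length_str_decode[OF j] by auto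
    qed
    then show ?thesis using Y(2)[OF y'] by blast
  qed
  then show thesis by (rule that)
qed

subsection \<open>Traps\<close>

lemma ex_heavy_subset:
  fixes w :: "'a \<Rightarrow> nat"
  assumes "finite V" "q \<le> card V"
  shows "\<exists>B\<subseteq>V. card B = q \<and> q * sum w V \<le> card V * sum w B"
  using assms
proof (induction V rule: finite_psubset_induct)
  case (psubset V)
  show ?case
  proof (cases "q = card V")
    case False
    then have "V \<noteq> {}" using psubset.prems by auto
    then obtain x where x: "x \<in> V" and x_min: "\<And>y. y \<in> V \<Longrightarrow> w x \<le> w y"
      using ex_min_if_finite[of "w ` V"] psubset.hyps by fastforce
    have card_V: "card V = Suc (card (V - {x}))"
      using card.remove[OF psubset.hyps x] .
    have "V - {x} \<subset> V" "q \<le> card (V - {x})"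
      using x card_V False psubset.prems by auto
    from psubset.IH[OF this] obtain B where B: "B \<subseteq> V - {x}" "card B = q"
      and heavy: "q * sum w (V - {x}) \<le> card (V - {x}) * sum w B"
      by blast
    have "q * w x \<le> sum w B"
      using sum_mono[of B "\<lambda>_. w x" w] B x_min by auto
    then have "q * sum w V \<le> card V * sum w B"
      using heavy unfolding card_V sum.remove[OF psubset.hyps x] by (simp add: algebra_simps)
    with B show ?thesis by blast
  qed blast
qed

lemma sum_card_fibres:
  assumes "finite Y" "finite B"
  shows "(\<Sum>b\<in>B. card {z \<in> Y. g z = b}) = card {z \<in> Y. g z \<in> B}"
proof -
  have "card (\<Union>b\<in>B. {z \<in> Y. g z = b}) = (\<Sum>b\<in>B. card {z \<in> Y. g z = b})"
    using assms by (intro card_UN_disjoint) auto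
  moreover have "(\<Union>b\<in>B. {z \<in> Y. g z = b}) = {z \<in> Y. g z \<in> B}" by blast
  ultimately show ?thesis by simp
qed

lemma ex_popular_values:
  assumes "finite Y" "finite V" "q \<le> card V" "g ` Y \<subseteq> V"
  shows "\<exists>B\<subseteq>V. card B = q \<and> q * card Y \<le> card V * card {z \<in> Y. g z \<in> B}"
proof -
  obtain B where B: "B \<subseteq> V" "card B = q"
    and heavy: "q * (\<Sum>b\<in>V. card {z \<in> Y. g z = b}) \<le> card V * (\<Sum>b\<in>B. card {z \<in> Y. g z = b})"
    using ex_heavy_subset[OF assms(2,3), of "\<lambda>b. card {z \<in> Y. g z = b}"] by blast
  have "finite B" using B(1) assms(2) finite_subset by blast
  moreover have "{z \<in> Y. g z \<in> V} = Y" using assms(4) by blast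
  ultimately have "q * card Y \<le> card V * card {z \<in> Y. g z \<in> B}"
    using heavy by (simp add: sum_card_fibres assms(1,2))
  with B show ?thesis by blast
qed

definition caught :: "('i \<Rightarrow> 'a \<Rightarrow> 'b option) \<Rightarrow> 'a set \<Rightarrow> 'i set \<Rightarrow> 'b set \<Rightarrow> 'a set" where
  "caught g Z S B = {z \<in> Z. \<forall>i\<in>S. g i z \<in> Some ` B}"

definition confined :: "('i \<Rightarrow> 'a \<Rightarrow> 'b option) \<Rightarrow> 'a set \<Rightarrow> 'i set \<Rightarrow> 'b set \<Rightarrow> 'a set" where
  "confined g Z K B = {z \<in> Z. \<forall>i\<in>K. set_option (g i z) \<subseteq> B}"

text \<open>Each index in \<open>S\<close> may cost \<open>q\<close> elements of \<open>B\<close> and a factor \<open>q / u\<close> of the caught inputs.\<close>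

definition trap :: "('i \<Rightarrow> 'a \<Rightarrow> 'b option) \<Rightarrow> 'a set \<Rightarrow> nat \<Rightarrow> nat \<Rightarrow> 'i set \<Rightarrow> 'b set \<Rightarrow> bool" where
  "trap g Z q u S B \<longleftrightarrow> finite B \<and> card B \<le> card S * q \<and>
     card Z * q ^ card S \<le> card (caught g Z S B) * u ^ card S"

lemma finite_caught: "finite Z \<Longrightarrow> finite (caught g Z S B)"
  unfolding caught_def by simp

lemma finite_confined: "finite Z \<Longrightarrow> finite (confined g Z K B)"
  unfolding confined_def by simp

lemma trap_mono:
  assumes "finite Z" "trap g Z q u S B" "B \<subseteq> B'" "finite B'" "card B' \<le> card S * q"
  shows "trap g Z q u S B'"
proof -
  have "caught g Z S B \<subseteq> caught g Z S B'" using assms(3) unfolding caught_def by blast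
  then have "card (caught g Z S B) \<le> card (caught g Z S B')"
    by (rule card_mono[OF finite_caught[OF assms(1)]])
  then have "card (caught g Z S B) * u ^ card S \<le> card (caught g Z S B') * u ^ card S"
    by (rule mult_le_mono1)
  then show ?thesis using assms unfolding trap_def by linarith
qed

lemma ex_caught_insert:
  assumes "finite Z" "finite V" "q \<le> card V" "\<forall>z\<in>Z. set_option (g i z) \<subseteq> V"
  shows "\<exists>B'. finite B' \<and> card B' = q \<and>
    q * card (caught g Z S B \<inter> dom (g i)) \<le> card V * card (caught g Z (insert i S) (B \<union> B'))"
proof -
  define Y where "Y = caught g Z S B \<inter> dom (g i)"
  have Y: "Y \<subseteq> Z" unfolding Y_def caught_def by blast
  then have "finite Y" using assms(1) finite_subset by blast
  have "(\<lambda>z. the (g i z)) ` Y \<subseteq> V" using assms(4) Y unfolding Y_def by force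
  from ex_popular_values[OF \<open>finite Y\<close> assms(2,3) this]
  obtain B' where B': "B' \<subseteq> V" "card B' = q"
    and popular: "q * card Y \<le> card V * card {z \<in> Y. the (g i z) \<in> B'}"
    by blast
  have "{z \<in> Y. the (g i z) \<in> B'} \<subseteq> caught g Z (insert i S) (B \<union> B')"
    unfolding Y_def caught_def by auto
  then have "card {z \<in> Y. the (g i z) \<in> B'} \<le> card (caught g Z (insert i S) (B \<union> B'))"
    by (rule card_mono[OF finite_caught[OF assms(1)]])
  with popular have "q * card Y \<le> card V * card (caught g Z (insert i S) (B \<union> B'))"
    by (meson le_trans mult_le_mono2)
  with B' show ?thesis unfolding Y_def using finite_subset[OF _ assms(2)] by blast
qed

lemma ex_trap_insert:
  assumes "finite Z" "finite V" "q \<le> card V" "\<forall>z\<in>Z. set_option (g i z) \<subseteq> V"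
    and S: "finite S" "i \<notin> S" and trap: "trap g Z q (c * card V) S B"
    and many: "card (caught g Z S B) \<le> c * card (caught g Z S B \<inter> dom (g i))"
  shows "\<exists>B'. trap g Z q (c * card V) (insert i S) B'"
proof -
  obtain B' where "finite B'" "card B' = q"
    and B': "q * card (caught g Z S B \<inter> dom (g i)) \<le>
        card V * card (caught g Z (insert i S) (B \<union> B'))"
    using ex_caught_insert[where g = g and i = i and S = S and B = B, OF assms(1-4)] by blast
  let ?X = "caught g Z S B" and ?X' = "caught g Z (insert i S) (B \<union> B')" and ?u = "c * card V"
  have "card Z * q ^ Suc (card S) = (card Z * q ^ card S) * q" by simp
  also have "\<dots> \<le> (card ?X * ?u ^ card S) * q"
    using trap unfolding trap_def by (intro mult_right_mono) auto
  also have "\<dots> \<le> (c * card (?X \<inter> dom (g i)) * ?u ^ card S) * q"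
    using many by (intro mult_right_mono) auto
  also have "\<dots> = (q * card (?X \<inter> dom (g i))) * (c * ?u ^ card S)" by (simp add: algebra_simps)
  also have "\<dots> \<le> (card V * card ?X') * (c * ?u ^ card S)"
    using B' by (rule mult_right_mono) simp
  also have "\<dots> = card ?X' * ?u ^ Suc (card S)" by (simp add: algebra_simps)
  finally have "card Z * q ^ Suc (card S) \<le> card ?X' * ?u ^ Suc (card S)" .
  moreover have "card (B \<union> B') \<le> Suc (card S) * q"
    using card_Un_le[of B B'] \<open>card B' = q\<close> trap unfolding trap_def by simp
  ultimately have "trap g Z q ?u (insert i S) (B \<union> B')"
    using S \<open>finite B'\<close> trap unfolding trap_def by simp
  then show ?thesis by blast
qed

lemma card_caught_le_confined:
  assumes "finite Z" "finite K"
    and few: "\<And>i. i \<in> K - S \<Longrightarrow>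
      Suc (card K) * card (caught g Z S B \<inter> dom (g i)) \<le> card (caught g Z S B)"
  shows "card (caught g Z S B) \<le> Suc (card K) * card (confined g Z K B)"
proof -
  let ?X = "caught g Z S B" and ?G = "confined g Z K B" and ?c = "Suc (card K)"
  let ?Y = "\<lambda>i. ?X \<inter> dom (g i)"
  have "?X \<subseteq> ?G \<union> (\<Union>i\<in>K - S. ?Y i)"
  proof
    fix z assume z: "z \<in> ?X"
    show "z \<in> ?G \<union> (\<Union>i\<in>K - S. ?Y i)"
    proof (cases "\<exists>i\<in>K - S. z \<in> dom (g i)")
      case False
      have "set_option (g i z) \<subseteq> B" if "i \<in> K" for i
        using that z False unfolding caught_def by (cases "i \<in> S") (auto simp: dom_def)
      then have "z \<in> ?G" using z by (simp add: caught_def confined_def)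
      then show ?thesis ..
    qed (use z in blast)
  qed
  moreover have "finite (?G \<union> (\<Union>i\<in>K - S. ?Y i))"
    using assms(1,2) by (simp add: finite_caught finite_confined)
  ultimately have "card ?X \<le> card (?G \<union> (\<Union>i\<in>K - S. ?Y i))"
    by (rule card_mono[rotated])
  also have "\<dots> \<le> card ?G + (\<Sum>i\<in>K - S. card (?Y i))"
    using card_Un_le[of ?G "\<Union>i\<in>K - S. ?Y i"] card_UN_le[of "K - S" ?Y] assms(2) by simp
  finally have "?c * card ?X \<le> ?c * (card ?G + (\<Sum>i\<in>K - S. card (?Y i)))"
    by (rule mult_le_mono2)
  also have "\<dots> = ?c * card ?G + (\<Sum>i\<in>K - S. ?c * card (?Y i))"
    by (simp only: add_mult_distrib2 sum_distrib_left)
  also have "(\<Sum>i\<in>K - S. ?c * card (?Y i)) \<le> (\<Sum>i\<in>K - S. card ?X)"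
    using few by (rule sum_mono)
  also have "\<dots> \<le> card K * card ?X"
    using card_mono[of K "K - S"] assms(2) by simp
  finally show ?thesis by simp
qed

lemma card_confined_ge_if_few_escape:
  assumes "finite Z" "finite K" "S \<subseteq> K" "q \<le> u" and trap: "trap g Z q u S B"
    and few: "\<And>i. i \<in> K - S \<Longrightarrow>
      Suc (card K) * card (caught g Z S B \<inter> dom (g i)) \<le> card (caught g Z S B)"
  shows "card Z * q ^ card K \<le> Suc (card K) * card (confined g Z K B) * u ^ card K"
proof -
  have "card S \<le> card K" using assms(2,3) by (rule card_mono)
  then have power_split: "a ^ card K = a ^ card S * a ^ (card K - card S)" for a :: nat
    by (simp add: power_add[symmetric])
  have "card Z * q ^ card K = (card Z * q ^ card S) * q ^ (card K - card S)"
    unfolding power_split by simp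
  also have "\<dots> \<le> (card (caught g Z S B) * u ^ card S) * u ^ (card K - card S)"
  proof (rule mult_le_mono)
    show "card Z * q ^ card S \<le> card (caught g Z S B) * u ^ card S"
      using trap unfolding trap_def by blast
    show "q ^ (card K - card S) \<le> u ^ (card K - card S)"
      using assms(4) by (rule power_mono) simp
  qed
  also have "\<dots> = card (caught g Z S B) * u ^ card K"
    unfolding power_split by simp
  also have "\<dots> \<le> Suc (card K) * card (confined g Z K B) * u ^ card K"
    using card_caught_le_confined[OF assms(1,2) few] by (rule mult_le_mono1)
  finally show ?thesis .
qed

lemma ex_maximal_trap:
  fixes g :: "'i \<Rightarrow> 'a \<Rightarrow> 'b option"
  assumes "finite Z" "finite V" "q \<le> card V" "finite K"
    and range: "\<forall>i\<in>K. \<forall>z\<in>Z. set_option (g i z) \<subseteq> V"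
  defines "u \<equiv> Suc (card K) * card V"
  obtains S B where "S \<subseteq> K" "trap g Z q u S B"
    "\<And>B. trap g Z q u S B \<Longrightarrow>
      card Z * q ^ card K \<le> Suc (card K) * card (confined g Z K B) * u ^ card K"
proof -
  define trappable where "trappable = {S \<in> Pow K. \<exists>B. trap g Z q u S B}"
  have "trap g Z q u {} {}" unfolding trap_def caught_def by simp
  then have "{} \<in> trappable" unfolding trappable_def by blast
  moreover have "finite trappable" unfolding trappable_def using assms(4) by simp
  ultimately obtain S where "S \<in> trappable"
    and S_max: "\<And>S'. S' \<in> trappable \<Longrightarrow> S \<subseteq> S' \<Longrightarrow> S = S'"
    using finite_has_maximal[of trappable] by blast
  then obtain B where S: "S \<subseteq> K" "trap g Z q u S B" unfolding trappable_def by blast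
  have "finite S" using S(1) assms(4) finite_subset by blast
  have "card Z * q ^ card K \<le> Suc (card K) * card (confined g Z K B) * u ^ card K"
    if trap: "trap g Z q u S B" for B
  proof (rule card_confined_ge_if_few_escape[OF assms(1,4) S(1) _ trap])
    show "q \<le> u" unfolding u_def using assms(3) by simp
    fix i assume i: "i \<in> K - S"
    show "Suc (card K) * card (caught g Z S B \<inter> dom (g i)) \<le> card (caught g Z S B)"
    proof (rule ccontr)
      assume "\<not> ?thesis"
      then have "\<exists>B'. trap g Z q u (insert i S) B'"
        using i range trap \<open>finite S\<close> unfolding u_def
        by (intro ex_trap_insert[OF assms(1-3)]) auto
      then have "insert i S \<in> trappable" using i S(1) unfolding trappable_def by blast
      then show False using S_max[of "insert i S"] i by blast
    qed
  qed
  with S that show thesis by blast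
qed

subsection \<open>Effective search for traps\<close>

lemma trap_str_nth_iff:
  fixes \<Gamma> :: "'i \<Rightarrow> bool list \<Rightarrow> bool list option"
  shows "trap \<Gamma> (strings m) (2 ^ l) u S (str_nth y ` {..<card S * 2 ^ l}) \<longleftrightarrow>
    (\<exists>K. K \<le> card {s \<in> strings m. \<forall>i\<in>S. \<exists>j<card S * 2 ^ l. \<Gamma> i s = Some (str_nth y j)} \<and>
      2 ^ m * (2 ^ l) ^ card S \<le> K * u ^ card S)"
    (is "?trap \<longleftrightarrow> (\<exists>K. K \<le> card ?X \<and> _)")
proof -
  have caught: "caught \<Gamma> (strings m) S (str_nth y ` {..<card S * 2 ^ l}) = ?X"
    unfolding caught_def by auto
  have "?trap \<longleftrightarrow> 2 ^ m * (2 ^ l) ^ card S \<le> card ?X * u ^ card S"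
    using card_image_le[of "{..<card S * 2 ^ l}" "str_nth y"]
    unfolding trap_def caught by (simp add: card_strings)
  also have "\<dots> \<longleftrightarrow> (\<exists>K\<le>card ?X. 2 ^ m * (2 ^ l) ^ card S \<le> K * u ^ card S)"
    by (meson le_trans mult_le_mono1 order_refl)
  finally show ?thesis .
qed

lemma semidecidable_trap:
  assumes "finite S" and \<Gamma>: "\<forall>i\<in>S. partial_computable (\<Gamma> i)"
    and m: "computable_nat m" and u: "computable_nat u"
  shows "semidecidable3 (\<lambda>e l y.
    trap \<Gamma> (strings (m e)) (2 ^ l) (u e) S (str_nth y ` {..<card S * 2 ^ l}))"
  unfolding trap_str_nth_iff str_nth_def
  by (intro computability_intros semidecidable_le_card semidecidable_ball_finite assms(1)
      semidecidable_string_graph[OF \<Gamma>[rule_format]] computable_nat_comp[OF m]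
      computable_nat_comp[OF u])

lemma ex_simple_trap:
  assumes U: "optimal_machine U" and S: "finite S" and \<Gamma>: "\<forall>i\<in>S. partial_computable (\<Gamma> i)"
    and m: "computable_nat m" and u: "computable_nat u"
  obtains c where "\<And>e l B. trap \<Gamma> (strings (m e)) (2 ^ l) (u e) S B \<Longrightarrow>
    \<exists>B'. trap \<Gamma> (strings (m e)) (2 ^ l) (u e) S B' \<and> (\<forall>t\<in>B'. plain_complexity U t \<le> e + l + c)"
proof -
  define B where "B l y = str_nth y ` {..<card S * 2 ^ l}" for l y
  define Q where "Q e l y \<longleftrightarrow> trap \<Gamma> (strings (m e)) (2 ^ l) (u e) S (B l y)" for e l y
  have "semidecidable3 Q"
    unfolding Q_def B_def using S \<Gamma> m u by (rule semidecidable_trap)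
  then obtain c where c: "\<And>e l y. Q e l y \<Longrightarrow>
      \<exists>y'. Q e l y' \<and> (\<forall>j<card S * 2 ^ l. plain_complexity U (str_nth y' j) \<le> e + l + c)"
    by (rule ex_simple_str_nth[OF U]) blast
  have "\<exists>B'. trap \<Gamma> (strings (m e)) (2 ^ l) (u e) S B' \<and> (\<forall>t\<in>B'. plain_complexity U t \<le> e + l + c)"
    if trap: "trap \<Gamma> (strings (m e)) (2 ^ l) (u e) S B\<^sub>0" for e l B\<^sub>0
  proof -
    have "finite B\<^sub>0" "card B\<^sub>0 \<le> card S * 2 ^ l" using trap unfolding trap_def by auto
    then obtain y where "B\<^sub>0 \<subseteq> B l y" unfolding B_def using ex_str_nth_superset by blast
    moreover have "finite (B l y)" "card (B l y) \<le> card S * 2 ^ l"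
      unfolding B_def using card_image_le[of "{..<card S * 2 ^ l}" "str_nth y"] by simp_all
    ultimately have "Q e l y"
      unfolding Q_def using trap_mono[OF finite_strings trap] by blast
    with c obtain y' where y': "Q e l y'"
      "\<forall>j<card S * 2 ^ l. plain_complexity U (str_nth y' j) \<le> e + l + c" by blast
    then have "\<forall>t\<in>B l y'. plain_complexity U t \<le> e + l + c" unfolding B_def by blast
    with y'(1) show ?thesis unfolding Q_def by blast
  qed
  then show thesis by (rule that)
qed

subsection \<open>Length bounds for extractors\<close>

lemma ex_uniform_bound_finite:
  fixes P :: "'i \<Rightarrow> nat \<Rightarrow> bool"
  assumes "finite I" "\<forall>i\<in>I. mono (P i)" "\<forall>i\<in>I. \<exists>c. P i c"
  shows "\<exists>c. \<forall>i\<in>I. P i c"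
proof -
  obtain c where c: "\<forall>i\<in>I. P i (c i)" using assms(3) by metis
  have "P i (sum c I)" if "i \<in> I" for i
    using c that assms(2) member_le_sum[OF that, of c] assms(1) by (auto dest!: monoD)
  then show ?thesis by blast
qed

lemma exponents_le_if_powers_le:
  fixes m l k L n :: nat
  assumes "2 ^ m * (2 ^ l) ^ k \<le> Suc k * 2 ^ L * (Suc k * 2 ^ n) ^ k"
  shows "m + l * k \<le> k + L + (k + n) * k"
proof -
  have "2 ^ (m + l * k) \<le> Suc k * 2 ^ L * (Suc k * 2 ^ n) ^ k"
    using assms by (simp only: power_add power_mult)
  also have "\<dots> \<le> 2 ^ k * 2 ^ L * (2 ^ k * 2 ^ n) ^ k"
    by (intro mult_le_mono power_mono) (auto simp: Suc_le_eq)
  also have "\<dots> = 2 ^ (k + L + (k + n) * k)"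
    by (simp only: power_add power_mult)
  finally show ?thesis
    by (rule power_le_imp_le_exp[rotated]) simp
qed

text \<open>The index \<open>e\<close> stands for \<open>log n\<close> in the error terms.\<close>

locale extractor_sequence =
  fixes U :: "bool list \<Rightarrow> bool list option" and I :: "'i set"
    and \<Gamma> :: "'i \<Rightarrow> bool list \<Rightarrow> bool list option" and m n :: "nat \<Rightarrow> nat" and \<alpha> \<beta> :: real and d :: nat
  assumes optimal: "optimal_machine U"
    and finite_I: "finite I"
    and computable_\<Gamma>: "\<And>i. i \<in> I \<Longrightarrow> partial_computable (\<Gamma> i)"
    and computable_m: "computable_nat m" and computable_n: "computable_nat n"
    and length_output: "\<And>e s i t. length s = m e \<Longrightarrow> i \<in> I \<Longrightarrow> \<Gamma> i s = Some t \<Longrightarrow> length t = n e"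
    and complex_output: "\<And>e s.
      length s = m e \<Longrightarrow> \<alpha> * real (m e) + real d \<le> real (plain_complexity U s) \<Longrightarrow>
      \<exists>i\<in>I. \<exists>t. \<Gamma> i s = Some t \<and> \<beta> * real (n e) - real d \<le> real (plain_complexity U t)"
    and \<alpha>_nonneg: "0 \<le> \<alpha>" and \<beta>_le_1: "\<beta> \<le> 1"
begin

lemma plain_complexity_output_le:
  obtains c where "\<And>i s t. i \<in> I \<Longrightarrow> \<Gamma> i s = Some t \<Longrightarrow> plain_complexity U t \<le> plain_complexity U s + c"
proof -
  let ?P = "\<lambda>i c. \<forall>s t. \<Gamma> i s = Some t \<longrightarrow> plain_complexity U t \<le> plain_complexity U s + c"
  have "\<forall>i\<in>I. mono (?P i)" by (fastforce intro: monoI)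
  moreover have "\<forall>i\<in>I. \<exists>c. ?P i c"
    using plain_complexity_image_le[OF optimal computable_\<Gamma>] by metis
  ultimately have "\<exists>c. \<forall>i\<in>I. ?P i c"
    by (rule ex_uniform_bound_finite[OF finite_I])
  then show thesis using that by blast
qed

lemma output_length_le:
  obtains c where "\<And>e. \<alpha> * real (m e) + real d + 1 \<le> real (m e) \<Longrightarrow>
    \<beta> * real (n e) \<le> \<alpha> * real (m e) + real e + real c"
proof -
  obtain c where c: "\<And>i s t. i \<in> I \<Longrightarrow> \<Gamma> i s = Some t \<Longrightarrow>
      plain_complexity U t \<le> plain_complexity U s + c"
    by (rule plain_complexity_output_le) blast
  obtain c' where c': "\<And>e l. l \<le> m e \<Longrightarrow>
      \<exists>s. length s = m e \<and> l \<le> plain_complexity U s \<and> plain_complexity U s \<le> e + l + c'"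
    using ex_plain_complexity_between[OF optimal computable_m] by metis
  have "\<beta> * real (n e) \<le> \<alpha> * real (m e) + real e + real (2 * d + 1 + c + c')"
    if room: "\<alpha> * real (m e) + real d + 1 \<le> real (m e)" for e
  proof -
    define l where "l = nat \<lceil>\<alpha> * real (m e) + real d\<rceil>"
    have "0 \<le> \<alpha> * real (m e) + real d" using \<alpha>_nonneg by simp
    then have l: "\<alpha> * real (m e) + real d \<le> real l" "real l < \<alpha> * real (m e) + real d + 1"
      unfolding l_def by linarith+
    with room have "l \<le> m e" by linarith
    then obtain s where s: "length s = m e" "l \<le> plain_complexity U s"
      "plain_complexity U s \<le> e + l + c'"
      using c' by blast
    with l(1) obtain i t where "i \<in> I" "\<Gamma> i s = Some t"
      and t: "\<beta> * real (n e) - real d \<le> real (plain_complexity U t)"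
      using complex_output[of s e] by force
    then have "plain_complexity U t \<le> e + l + c' + c" using c[of i s t] s(3) by linarith
    with t l(2) show ?thesis by linarith
  qed
  then show thesis by (rule that)
qed

lemma card_confined_less:
  assumes simple: "\<And>t. t \<in> B \<Longrightarrow> real (plain_complexity U t) < \<beta> * real (n e) - real d"
  shows "card (confined \<Gamma> (strings (m e)) I B) < 2 ^ nat \<lceil>\<alpha> * real (m e) + real d\<rceil>"
proof -
  let ?L = "nat \<lceil>\<alpha> * real (m e) + real d\<rceil>"
  have "confined \<Gamma> (strings (m e)) I B \<subseteq> {s. plain_complexity U s < ?L}"
  proof
    fix s assume "s \<in> confined \<Gamma> (strings (m e)) I B"
    then have s: "length s = m e" "\<And>i t. i \<in> I \<Longrightarrow> \<Gamma> i s = Some t \<Longrightarrow> t \<in> B"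
      unfolding confined_def by auto
    have "real (plain_complexity U s) < \<alpha> * real (m e) + real d"
      using complex_output[OF s(1)] s(2) simple by (meson not_le)
    then show "s \<in> {s. plain_complexity U s < ?L}" by simp linarith
  qed
  then show ?thesis
    using card_mono[OF finite_plain_complexity_less(1)[OF optimal]]
      finite_plain_complexity_less(2)[OF optimal] by (meson le_less_trans)
qed

lemma ex_simple_traps:
  assumes u: "computable_nat u"
  obtains c where "\<And>S e l B. S \<subseteq> I \<Longrightarrow> trap \<Gamma> (strings (m e)) (2 ^ l) (u e) S B \<Longrightarrow>
    \<exists>B'. trap \<Gamma> (strings (m e)) (2 ^ l) (u e) S B' \<and> (\<forall>t\<in>B'. plain_complexity U t \<le> e + l + c)"
proof -
  let ?P = "\<lambda>S c. \<forall>e l B. trap \<Gamma> (strings (m e)) (2 ^ l) (u e) S B \<longrightarrow>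
      (\<exists>B'. trap \<Gamma> (strings (m e)) (2 ^ l) (u e) S B' \<and> (\<forall>t\<in>B'. plain_complexity U t \<le> e + l + c))"
  have "\<forall>S\<in>Pow I. mono (?P S)" by (fastforce intro: monoI)
  moreover have "\<forall>S\<in>Pow I. \<exists>c. ?P S c"
  proof
    fix S assume "S \<in> Pow I"
    then have S: "finite S" "\<forall>i\<in>S. partial_computable (\<Gamma> i)"
      using finite_I finite_subset computable_\<Gamma> by blast+
    obtain c where "\<And>e l B. trap \<Gamma> (strings (m e)) (2 ^ l) (u e) S B \<Longrightarrow>
        \<exists>B'. trap \<Gamma> (strings (m e)) (2 ^ l) (u e) S B' \<and> (\<forall>t\<in>B'. plain_complexity U t \<le> e + l + c)"
      by (rule ex_simple_trap[OF optimal S computable_m u]) (rule that)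
    then show "\<exists>c. ?P S c" by blast
  qed
  ultimately have "\<exists>c. \<forall>S\<in>Pow I. ?P S c"
    using finite_I by (intro ex_uniform_bound_finite) simp_all
  then show thesis using that by blast
qed

lemma card_inputs_le:
  obtains c where "\<And>e l. real l + real e + real c < \<beta> * real (n e) - real d \<Longrightarrow>
    2 ^ m e * (2 ^ l) ^ card I \<le>
      Suc (card I) * 2 ^ nat \<lceil>\<alpha> * real (m e) + real d\<rceil> * (Suc (card I) * 2 ^ n e) ^ card I"
proof -
  let ?k = "card I"
  let ?trap = "\<lambda>e l. trap \<Gamma> (strings (m e)) (2 ^ l) (Suc ?k * 2 ^ n e)"
  obtain c where c: "\<And>S e l B. S \<subseteq> I \<Longrightarrow> ?trap e l S B \<Longrightarrow>
      \<exists>B'. ?trap e l S B' \<and> (\<forall>t\<in>B'. plain_complexity U t \<le> e + l + c)"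
    by (rule ex_simple_traps[of "\<lambda>e. Suc ?k * 2 ^ n e"])
      (intro computability_intros computable_n, rule that)
  have "2 ^ m e * (2 ^ l) ^ ?k \<le>
      Suc ?k * 2 ^ nat \<lceil>\<alpha> * real (m e) + real d\<rceil> * (Suc ?k * 2 ^ n e) ^ ?k"
    if small: "real l + real e + real c < \<beta> * real (n e) - real d" for e l
  proof -
    let ?V = "strings (n e)"
    have "\<beta> * real (n e) \<le> real (n e)" using mult_right_mono[OF \<beta>_le_1, of "real (n e)"] by simp
    with small have "l \<le> n e" by linarith
    then have "2 ^ l \<le> card ?V" by (simp add: card_strings)
    moreover have "\<forall>i\<in>I. \<forall>s\<in>strings (m e). set_option (\<Gamma> i s) \<subseteq> ?V"
      using length_output by auto
    ultimately obtain S B where "S \<subseteq> I" "?trap e l S B"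
      and maximal: "\<And>B. ?trap e l S B \<Longrightarrow> card (strings (m e)) * (2 ^ l) ^ ?k \<le>
          Suc ?k * card (confined \<Gamma> (strings (m e)) I B) * (Suc ?k * 2 ^ n e) ^ ?k"
      using ex_maximal_trap[OF finite_strings finite_strings _ finite_I, of "2 ^ l" "n e" "m e" \<Gamma>]
      by (metis card_strings)
    then obtain B' where B': "?trap e l S B'" "\<forall>t\<in>B'. plain_complexity U t \<le> e + l + c"
      using c by blast
    have "2 ^ m e * (2 ^ l) ^ ?k \<le>
        Suc ?k * card (confined \<Gamma> (strings (m e)) I B') * (Suc ?k * 2 ^ n e) ^ ?k"
      using maximal[OF B'(1)] by (simp only: card_strings)
    also have "\<dots> \<le> Suc ?k * 2 ^ nat \<lceil>\<alpha> * real (m e) + real d\<rceil> * (Suc ?k * 2 ^ n e) ^ ?k"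
    proof (intro mult_le_mono1 mult_le_mono2 less_imp_le card_confined_less)
      fix t assume "t \<in> B'"
      then have "plain_complexity U t \<le> e + l + c" using B'(2) by blast
      then show "real (plain_complexity U t) < \<beta> * real (n e) - real d" using small by linarith
    qed
    finally show ?thesis .
  qed
  then show thesis by (rule that)
qed

lemma input_length_le:
  obtains c where "\<And>e. real e + real c \<le> \<beta> * real (n e) \<Longrightarrow>
    (1 - \<alpha>) * real (m e) \<le> real (card I) * (1 - \<beta>) * real (n e) + real (card I) * real e + real c"
proof -
  let ?k = "card I"
  obtain c where c: "\<And>e l. real l + real e + real c < \<beta> * real (n e) - real d \<Longrightarrow>
      2 ^ m e * (2 ^ l) ^ ?k \<le>
        Suc ?k * 2 ^ nat \<lceil>\<alpha> * real (m e) + real d\<rceil> * (Suc ?k * 2 ^ n e) ^ ?k"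
    by (rule card_inputs_le) (rule that)
  define C where "C = d + c + ?k + 2 + ?k * (d + c + ?k + 2)"
  have "(1 - \<alpha>) * real (m e) \<le> real ?k * (1 - \<beta>) * real (n e) + real ?k * real e + real C"
    if C: "real e + real C \<le> \<beta> * real (n e)" for e
  proof -
    define x where "x = \<beta> * real (n e) - real d - real e - real c"
    define l where "l = nat (\<lceil>x\<rceil> - 1)"
    have "1 + real d + real c \<le> real C" unfolding C_def by simp
    then have "1 \<le> x" using C unfolding x_def by linarith
    then have l: "real l < x" "x - 1 \<le> real l" unfolding l_def by linarith+
    let ?L = "nat \<lceil>\<alpha> * real (m e) + real d\<rceil>"
    have "real l + real e + real c < \<beta> * real (n e) - real d" using l(1) unfolding x_def by linarith
    then have "m e + l * ?k \<le> ?k + ?L + (?k + n e) * ?k"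
      by (intro exponents_le_if_powers_le c)
    then have "real (m e + l * ?k) \<le> real (?k + ?L + (?k + n e) * ?k)" by (rule of_nat_mono)
    moreover have "real ?L < \<alpha> * real (m e) + real d + 1"
    proof -
      have "0 \<le> \<alpha> * real (m e) + real d" using \<alpha>_nonneg by simp
      then show ?thesis by linarith
    qed
    moreover have "(x - 1) * real ?k \<le> real l * real ?k"
      using l(2) by (rule mult_right_mono) simp
    ultimately have "real (m e) + (x - 1) * real ?k \<le>
        real ?k + (\<alpha> * real (m e) + real d + 1) + (real ?k + real (n e)) * real ?k"
      by (simp add: distrib_right)
    then show ?thesis unfolding x_def C_def by (simp add: algebra_simps)
  qed
  then show thesis by (rule that)
qed

lemma input_length_asymptotics:
  assumes "0 < \<alpha>" "\<alpha> < 1" and \<kappa>: "\<beta> = \<alpha> * \<kappa>" "real (card I) * (1 - \<beta>) = (1 - \<alpha>) * \<kappa>"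
    and m_at_top: "filterlim m at_top sequentially"
    and n_large: "\<And>c. \<forall>\<^sub>F e in sequentially. real e + real c \<le> \<beta> * real (n e)"
  obtains D where "0 \<le> D"
    "\<forall>\<^sub>F e in sequentially. \<bar>real (m e) - \<kappa> * real (n e)\<bar> \<le> D * (real e + 1)"
proof -
  obtain c where c: "\<And>e. \<alpha> * real (m e) + real d + 1 \<le> real (m e) \<Longrightarrow>
      \<beta> * real (n e) \<le> \<alpha> * real (m e) + real e + real c"
    by (rule output_length_le) blast
  obtain c' where c': "\<And>e. real e + real c' \<le> \<beta> * real (n e) \<Longrightarrow> (1 - \<alpha>) * real (m e) \<le>
      real (card I) * (1 - \<beta>) * real (n e) + real (card I) * real e + real c'"
    by (rule input_length_le) blast
  define D where "D = (1 + real c) / \<alpha> + (real (card I) + real c') / (1 - \<alpha>)"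
  have "\<forall>\<^sub>F e in sequentially. nat \<lceil>(real d + 1) / (1 - \<alpha>)\<rceil> \<le> m e"
    using m_at_top unfolding filterlim_at_top by blast
  with n_large[of c']
  have "\<forall>\<^sub>F e in sequentially. \<bar>real (m e) - \<kappa> * real (n e)\<bar> \<le> D * (real e + 1)"
  proof eventually_elim
    case (elim e)
    have "(real d + 1) / (1 - \<alpha>) \<le> real (m e)" using elim(2) by linarith
    then have "\<alpha> * real (m e) + real d + 1 \<le> real (m e)" using \<open>\<alpha> < 1\<close> by (simp add: field_simps)
    from c[OF this] have "\<alpha> * (\<kappa> * real (n e) - real (m e)) \<le> real e + c"
      unfolding \<kappa>(1) by (simp add: algebra_simps)
    also have "\<dots> \<le> (1 + real c) * (real e + 1)" by (simp add: algebra_simps)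
    finally have lower: "\<kappa> * real (n e) - real (m e) \<le> (1 + real c) / \<alpha> * (real e + 1)"
      using \<open>0 < \<alpha>\<close> by (simp add: field_simps)
    have "(1 - \<alpha>) * (real (m e) - \<kappa> * real (n e)) \<le> real (card I) * real e + real c'"
      using c'[OF elim(1)] unfolding \<kappa>(2) by (simp add: algebra_simps)
    also have "\<dots> \<le> (real (card I) + real c') * (real e + 1)" by (simp add: algebra_simps)
    finally have upper:
      "real (m e) - \<kappa> * real (n e) \<le> (real (card I) + real c') / (1 - \<alpha>) * (real e + 1)"
      using \<open>\<alpha> < 1\<close> by (simp add: field_simps)
    have "0 \<le> (1 + real c) / \<alpha> * (real e + 1)"
      "0 \<le> (real (card I) + real c') / (1 - \<alpha>) * (real e + 1)"
      using assms(1,2) by simp_all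
    with lower upper show ?case unfolding D_def distrib_right by linarith
  qed
  moreover have "0 \<le> D" unfolding D_def using assms(1,2) by simp
  ultimately show thesis using that by blast
qed

end

subsection \<open>The critical line\<close>

lemma int_encode_diff: "int_encode (int p - int q) = 2 * (p - q) + (2 * (q - p) - 1)"
  by (auto simp: int_encode_def sum_encode_def)

lemma computable_realI:
  assumes "computable_nat a" "computable_nat a'" "computable_nat b"
    and "\<forall>\<^sub>F j in sequentially.
      0 < b j \<and> \<bar>x - (real (a j) - real (a' j)) / real (b j)\<bar> \<le> D / 2 ^ j"
  shows "computable_real x"
proof -
  obtain N where N: "\<And>j. N \<le> j \<Longrightarrow>
      0 < b j \<and> \<bar>x - (real (a j) - real (a' j)) / real (b j)\<bar> \<le> D / 2 ^ j"
    using assms(4) unfolding eventually_sequentially by blast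
  define F where "F = max N (nat \<lceil>D\<rceil>)"
  have "D \<le> real F" unfolding F_def by linarith
  also have "\<dots> \<le> 2 ^ F" using of_nat_less_two_power[of F] by (rule less_imp_le)
  finally have D: "D \<le> 2 ^ F" .
  define num where "num j = int_encode (int (a (j + F)) - int (a' (j + F)))" for j
  define den where "den j = b (j + F) - 1" for j
  have "\<bar>x - of_int (int_decode (num j)) / of_nat (Suc (den j))\<bar> \<le> 1 / 2 ^ j" for j
  proof -
    have "\<bar>x - of_int (int_decode (num j)) / of_nat (Suc (den j))\<bar> \<le> D / 2 ^ (j + F)"
      using N[of "j + F"] unfolding num_def den_def F_def by simp
    also have "\<dots> \<le> 2 ^ F / 2 ^ (j + F)" using D by (simp add: divide_right_mono)
    finally show ?thesis by (simp add: power_add)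
  qed
  moreover have "computable_nat num" "computable_nat den"
    unfolding num_def den_def int_encode_diff
    by (intro computability_intros assms(1-3)[THEN computable_nat_comp])+
  ultimately show ?thesis unfolding computable_real_def by blast
qed

lemma filterlim_at_top_if_inj:
  fixes f :: "nat \<Rightarrow> nat"
  assumes "inj f"
  shows "filterlim f at_top sequentially"
  unfolding filterlim_at_top
proof
  fix z
  have "{x. \<not> z \<le> f x} = f -` {..<z}" by auto
  then have "finite {x. \<not> z \<le> f x}" using finite_vimageI[OF _ assms] by simp
  then show "\<forall>\<^sub>F x in sequentially. z \<le> f x"
    unfolding cofinite_eq_sequentially[symmetric] eventually_cofinite .
qed

lemma eventually_add_const_le_exp:
  fixes c \<beta> r :: real
  assumes "0 < \<beta>" "1 < r"
  shows "\<forall>\<^sub>F e in sequentially. real e + c \<le> \<beta> * r ^ e"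
proof -
  have "norm (1 / r) < 1" using assms(2) by simp
  then have "(\<lambda>e. real e * (1 / r) ^ e + c * (1 / r) ^ e) \<longlonglongrightarrow> 0 + c * 0"
    by (intro tendsto_intros powser_times_n_limit_0 LIMSEQ_power_zero)
  then have "\<forall>\<^sub>F e in sequentially. real e * (1 / r) ^ e + c * (1 / r) ^ e < \<beta>"
    using assms(1) by (intro order_tendstoD(2)) simp_all
  then show ?thesis
  proof eventually_elim
    case (elim e)
    then have "(real e + c) / r ^ e < \<beta>" by (simp add: power_one_over add_divide_distrib)
    then show ?case using assms(2) by (simp add: pos_divide_less_eq)
  qed
qed

lemma critical_ratio:
  fixes k \<alpha> \<beta> :: real
  assumes "1 \<le> k" "0 \<le> \<alpha>" "\<beta> = k * \<alpha> / (1 + (k - 1) * \<alpha>)"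
  defines "\<kappa> \<equiv> k - (k - 1) * \<beta>"
  shows "\<beta> = \<alpha> * \<kappa>" "k * (1 - \<beta>) = (1 - \<alpha>) * \<kappa>"
proof -
  have "0 < 1 + (k - 1) * \<alpha>" using assms(1,2) by (simp add: add_pos_nonneg)
  then have "\<beta> * (1 + (k - 1) * \<alpha>) = k * \<alpha>" unfolding assms(3) by simp
  then show "\<beta> = \<alpha> * \<kappa>" "k * (1 - \<beta>) = (1 - \<alpha>) * \<kappa>"
    unfolding \<kappa>_def by (simp_all add: algebra_simps)
qed

lemma abs_critical_error_le:
  fixes k \<beta> x y :: real
  assumes "2 \<le> k" "0 < y"
  shows "\<bar>\<beta> - (k * y - x) / ((k - 1) * y)\<bar> \<le> \<bar>x - (k - (k - 1) * \<beta>) * y\<bar> / y"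
proof -
  have "\<beta> - (k * y - x) / ((k - 1) * y) = (x - (k - (k - 1) * \<beta>) * y) / ((k - 1) * y)"
    using assms by (simp add: field_simps)
  then have "\<bar>\<beta> - (k * y - x) / ((k - 1) * y)\<bar> = \<bar>x - (k - (k - 1) * \<beta>) * y\<bar> / ((k - 1) * y)"
    using assms by simp
  also have "\<dots> \<le> \<bar>x - (k - (k - 1) * \<beta>) * y\<bar> / y"
    using assms by (intro divide_left_mono) simp_all
  finally show ?thesis .
qed

lemma extractor_sequence_if_extracts:
  assumes "optimal_machine U" "computable_nat f" "computable_nat n"
    and "\<forall>i\<in>{1..k}. partial_computable (\<Gamma> i)" "extracts U k \<alpha> \<beta> f \<Gamma> d" "0 \<le> \<alpha>" "\<beta> \<le> 1"
  shows "extractor_sequence U {1..k} \<Gamma> (\<lambda>e. f (n e)) n \<alpha> \<beta> d"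
proof
  show "computable_nat (\<lambda>e. f (n e))" by (rule computable_nat_comp[OF assms(2,3)])
next
  fix e and s :: "bool list" assume s: "length s = f (n e)"
  show length_t: "length t = n e" if "i \<in> {1..k}" "\<Gamma> i s = Some t" for i t
    using assms(5) s that unfolding extracts_def by blast
  assume "\<alpha> * real (f (n e)) + real d \<le> real (plain_complexity U s)"
  then have "\<exists>i\<in>{1..k}. \<exists>t. \<Gamma> i s = Some t \<and>
      \<beta> * real (length t) - real d \<le> real (plain_complexity U t)"
    using assms(5) s unfolding extracts_def by metis
  then show "\<exists>i\<in>{1..k}. \<exists>t. \<Gamma> i s = Some t \<and> \<beta> * real (n e) - real d \<le> real (plain_complexity U t)"
    using length_t by metis
qed (use assms in simp_all)

lemma computable_real_if_length_ratio:
  assumes "2 \<le> k" and m: "computable_nat m" and "0 \<le> D"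
    and "\<forall>\<^sub>F e in sequentially.
      \<bar>real (m e) - (real k - (real k - 1) * \<beta>) * real (4 ^ e)\<bar> \<le> D * (real e + 1)"
  shows "computable_real \<beta>"
proof -
  from assms(4) have "\<forall>\<^sub>F e in sequentially. 0 < (k - 1) * 4 ^ e \<and>
      \<bar>\<beta> - (real (k * 4 ^ e) - real (m e)) / real ((k - 1) * 4 ^ e)\<bar> \<le> D / 2 ^ e"
  proof eventually_elim
    case (elim e)
    have "real (Suc e) \<le> real (2 ^ e)" using less_exp[of e] by (simp only: of_nat_le_iff Suc_le_eq)
    then have e_le: "real e + 1 \<le> 2 ^ e" by simp
    have "\<bar>\<beta> - (real k * 4 ^ e - real (m e)) / ((real k - 1) * 4 ^ e)\<bar> \<le>
        \<bar>real (m e) - (real k - (real k - 1) * \<beta>) * 4 ^ e\<bar> / 4 ^ e"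
      using assms(1) by (intro abs_critical_error_le) simp_all
    also have "\<dots> \<le> D * (real e + 1) / 4 ^ e"
      using elim by (intro divide_right_mono) simp_all
    also have "\<dots> \<le> D * 2 ^ e / 4 ^ e"
      using e_le assms(3) by (intro divide_right_mono mult_left_mono) simp_all
    also have "\<dots> = D / 2 ^ e"
      using power_mult_distrib[of "2::real" 2 e] by simp
    finally show ?case using assms(1) by simp
  qed
  then show ?thesis
    by (rule computable_realI[rotated 3]) (intro computability_intros m)+
qed

lemma computable_real_if_EXTp_critical:
  assumes U: "optimal_machine U" and k: "2 \<le> k" and \<alpha>: "\<alpha> \<in> {0<..<1}" and \<beta>: "\<beta> \<in> {0<..<1}"
    and critical: "\<beta> = real k * \<alpha> / (1 + (real k - 1) * \<alpha>)" and mem: "(\<alpha>, \<beta>) \<in> EXTp U k"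
  shows "computable_real \<beta>"
proof -
  obtain f \<Gamma> d where inj: "inj f" and f: "computable_nat f"
    and \<Gamma>: "\<forall>i\<in>{1..k}. partial_computable (\<Gamma> i)" and extracts: "extracts U k \<alpha> \<beta> f \<Gamma> d"
    using mem unfolding EXTp_def by blast
  define \<kappa> where "\<kappa> = real k - (real k - 1) * \<beta>"
  have "computable_nat (\<lambda>e. 4 ^ e)" by (intro computability_intros)
  then interpret extractor_sequence U "{1..k}" \<Gamma> "\<lambda>e. f (4 ^ e)" "\<lambda>e. 4 ^ e" \<alpha> \<beta> d
    using U f \<Gamma> extracts \<alpha> \<beta> by (intro extractor_sequence_if_extracts) simp_all
  have "1 \<le> real k" "0 \<le> \<alpha>" using k \<alpha> by simp_all
  note critical_ratio[OF this critical, folded \<kappa>_def]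
  then have \<kappa>: "\<beta> = \<alpha> * \<kappa>" "real (card {1..k}) * (1 - \<beta>) = (1 - \<alpha>) * \<kappa>"
    unfolding card_atLeastAtMost diff_Suc_1 .
  have "inj (\<lambda>e. f (4 ^ e))"
    by (rule injI) (simp add: inj_eq[OF inj])
  then have lengths: "filterlim (\<lambda>e. f (4 ^ e)) at_top sequentially"
    by (rule filterlim_at_top_if_inj)
  have "\<forall>\<^sub>F e in sequentially. real e + c \<le> \<beta> * real (4 ^ e)" for c
    using eventually_add_const_le_exp[of \<beta> 4 c] \<beta> by simp
  then obtain D where "0 \<le> D"
    and "\<forall>\<^sub>F e in sequentially. \<bar>real (f (4 ^ e)) - \<kappa> * real (4 ^ e)\<bar> \<le> D * (real e + 1)"
    using input_length_asymptotics[OF _ _ \<kappa> lengths] \<alpha> by auto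
  then show ?thesis
    unfolding \<kappa>_def by (rule computable_real_if_length_ratio[OF k computable_m])
qed

theorem theorem31:
  fixes U :: "bool list \<Rightarrow> bool list option" and k :: nat and \<alpha> \<beta> :: real
  assumes "optimal_machine U"
    and "k \<ge> 2"
    and "\<alpha> \<in> {0<..<1}" and "\<beta> \<in> {0<..<1}"
    and "\<beta> = real k * \<alpha> / (1 + (real k - 1) * \<alpha>)"
    and "\<not> computable_real \<alpha>" and "\<not> computable_real \<beta>"
  shows "(\<alpha>, \<beta>) \<notin> EXTp U k \<and> (\<alpha>, \<beta>) \<notin> EXT U k"
proof -
  have "EXT U k \<subseteq> EXTp U k"
    unfolding EXT_def EXTp_def total_computable_def by blast
  moreover have "(\<alpha>, \<beta>) \<notin> EXTp U k"
    using computable_real_if_EXTp_critical[OF assms(1-5)] assms(7) by blast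
  ultimately show ?thesis by blast
qed

end
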